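(* Let $(X,d)$ and $(Y,\rho)$ be complete metric spaces, let $s>0$, and let $f\colon X\to Y$ be Lipschitz. Suppose $\mathcal{H}^s(X)<\infty$ and that for $\mathcal{H}^s$-almost every $x\in X$ there exists $0<\lambda_x\leq 1$ such that \[ \limsup_{r\to 0}\frac{\mathcal{H}^s\big(B(f(x),\lambda_x r)\setminus f(B(x,r))\big)}{(2\lambda_x r)^s} < \frac12\,\Theta^s_*(Y,f(x)). \] Then there exists a countable Borel decomposition $X=N\cup\bigcup_{i} X_i$ with $\mathcal{H}^s(N)=0$ such that for each $i$ the restriction $f|_{X_i}$ is bi-Lipschitz.
   Context: $\mathcal{H}^s$ denotes the $s$-dimensional Hausdorff (outer) measure on a metric space, and $B(z,r)$ denotes the ball of radius $r$ centred at $z$. For a subset $S$ of a metric space and a point $z$, the lower $s$-density is $\Theta^s_*(S,z):=\liminf_{r\to0}\frac{\mathcal{H}^s(B(z,r)\cap S)}{(2r)^s}$. A map $f$ is Lipschitz if $\rho(f(x),f(y))\leq L\,d(x,y)$ for some $L\ge 0$ and all $x,y$; an injective Lipschitz map is bi-Lipschitz if its inverse is also Lipschitz. *)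

theory Defs
  imports "HOL-Analysis.Analysis"
begin

definition hausdorff_pre :: "real \<Rightarrow> real \<Rightarrow> 'a::metric_space set \<Rightarrow> ennreal" where
  "hausdorff_pre s \<delta> A =
     (INF C \<in> {C :: nat \<Rightarrow> 'a set. A \<subseteq> (\<Union>i. C i) \<and> (\<forall>i. bounded (C i) \<and> diameter (C i) \<le> \<delta>)}.
        (\<Sum>i. ennreal (diameter (C i) powr s)))"

definition hausdorff :: "real \<Rightarrow> 'a::metric_space set \<Rightarrow> ennreal" where
  "hausdorff s A = (SUP \<delta> \<in> {0<..}. hausdorff_pre s \<delta> A)"

definition lower_density :: "real \<Rightarrow> 'a::metric_space set \<Rightarrow> 'a \<Rightarrow> ennreal" where
  "lower_density s S z =
     Liminf (at_right 0) (\<lambda>r. hausdorff s (ball z r \<inter> S) / ennreal ((2 * r) powr s))"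

end

theory Submission
  imports Defs
begin

text \<open>
  Call \<open>x\<close> good when, uniformly at small scales, \<open>f ` ball x r\<close> misses less than half of
  \<open>ball (f x) (l * r)\<close>; by countably many rational choices of the constants, almost every point is good.

  Preimages of null sets are null on good points: at a density point of such a preimage the images of
  small balls would be too small to fill their share of the target. Since \<open>f\<close> is Lipschitz and the
  domain has finite measure, almost every point of the target has a finite fibre, so the sets \<open>M \<rho>\<close> of
  points having two distinct preimages at distance at most \<open>\<rho>\<close> decrease to a null set. Hence for almost
  every good \<open>x\<close> some \<open>M \<rho>\<close> does not contain \<open>f x\<close> and, by the density theorem, has density zero at \<open>f x\<close>.

  If now \<open>y\<close> is good, close to \<open>x\<close>, and \<open>dist (f x) (f y)\<close> is much smaller than \<open>dist x y = 2 * r\<close>, the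
  images of the disjoint balls \<open>ball x r\<close> and \<open>ball y r\<close> both fill more than half of almost the same
  ball, so they overlap in a fixed proportion of it. The overlap lies in \<open>M \<rho>\<close>, a contradiction. So
  \<open>f\<close> is bi-Lipschitz near \<open>x\<close> on the good points, and this bound passes to closures, which makes the
  pieces Borel.
\<close>

section \<open>Hausdorff measure\<close>

lemma diameter_leI:
  fixes S :: "'a::metric_space set"
  assumes "0 \<le> d" "\<And>x y. x \<in> S \<Longrightarrow> y \<in> S \<Longrightarrow> dist x y \<le> d"
  shows "diameter S \<le> d"
  using assms by (auto simp: diameter_def intro!: cSUP_least)

lemma boundedI_dist:
  fixes S :: "'a::metric_space set"
  assumes "\<And>x y. x \<in> S \<Longrightarrow> y \<in> S \<Longrightarrow> dist x y \<le> d"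
  shows "bounded S"
proof (cases "S = {}")
  case False
  then obtain x where "x \<in> S" by auto
  then show ?thesis using assms unfolding bounded_def by blast
qed simp

section \<open>Covers at a fixed scale and countable subadditivity\<close>

lemma hausdorff_pre_le:
  assumes "A \<subseteq> (\<Union>i. C i)" "\<And>i. bounded (C i)" "\<And>i. diameter (C i) \<le> \<delta>"
  shows "hausdorff_pre s \<delta> A \<le> (\<Sum>i. ennreal (diameter (C i) powr s))"
  unfolding hausdorff_pre_def using assms by (intro INF_lower) auto

lemma hausdorff_pre_near_cover:
  assumes "hausdorff_pre s \<delta> A < e"
  obtains C :: "nat \<Rightarrow> 'a::metric_space set"
  where "A \<subseteq> (\<Union>i. C i)" "\<And>i. bounded (C i)" "\<And>i. diameter (C i) \<le> \<delta>"
    "(\<Sum>i. ennreal (diameter (C i) powr s)) < e"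
  using assms unfolding hausdorff_pre_def INF_less_iff by auto

lemma hausdorff_pre_mono:
  assumes "A \<subseteq> B"
  shows "hausdorff_pre s \<delta> A \<le> hausdorff_pre s \<delta> B"
  unfolding hausdorff_pre_def using assms by (intro INF_superset_mono) auto

lemma hausdorff_pre_antimono:
  assumes "\<delta> \<le> \<delta>'"
  shows "hausdorff_pre s \<delta>' A \<le> hausdorff_pre s \<delta> A"
  unfolding hausdorff_pre_def using assms by (intro INF_superset_mono) (auto intro: order_trans)

lemma hausdorff_pre_le_hausdorff: "0 < \<delta> \<Longrightarrow> hausdorff_pre s \<delta> A \<le> hausdorff s A"
  unfolding hausdorff_def by (intro SUP_upper) auto

lemma hausdorff_mono: "A \<subseteq> B \<Longrightarrow> hausdorff s A \<le> hausdorff s B"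
  unfolding hausdorff_def by (intro SUP_mono') (auto intro: hausdorff_pre_mono)

lemma hausdorff_leI:
  assumes "\<And>\<delta>. 0 < \<delta> \<Longrightarrow> hausdorff_pre s \<delta> A \<le> c"
  shows "hausdorff s A \<le> c"
  unfolding hausdorff_def using assms by (intro SUP_least) auto

lemma hausdorff_empty [simp]: "hausdorff s {} = 0"
proof -
  have "hausdorff_pre s \<delta> {} \<le> 0" if "0 < \<delta>" for \<delta>
    using hausdorff_pre_le[of "{}" "\<lambda>_. {}" \<delta> s] that by simp
  then show ?thesis using hausdorff_leI by (metis le_zero_eq)
qed

text \<open>Each \<open>A i\<close> is covered within \<open>e * (1/2) ^ Suc i\<close> of the
  optimum. The doubly indexed covers are listed through \<open>prod_decode\<close>, and the errors
  add up to \<open>e\<close>.\<close>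

lemma hausdorff_pre_UN_le:
  fixes A :: "nat \<Rightarrow> 'a::metric_space set"
  shows "hausdorff_pre s \<delta> (\<Union>i. A i) \<le> (\<Sum>i. hausdorff_pre s \<delta> (A i))"
proof (rule ennreal_le_epsilon)
  fix e :: real
  assume fin: "(\<Sum>i. hausdorff_pre s \<delta> (A i)) < top" and e: "0 < e"
  have "\<exists>C. A i \<subseteq> (\<Union>j. C j) \<and> (\<forall>j. bounded (C j) \<and> diameter (C j) \<le> \<delta>) \<and>
      (\<Sum>j. ennreal (diameter (C j :: 'a set) powr s)) \<le> hausdorff_pre s \<delta> (A i) + ennreal (e * (1/2) ^ Suc i)" for i
  proof -
    \<comment> \<open>Only below \<open>top\<close> is adding a positive error a strict increase,
      which is what yields a nearly optimal cover.\<close>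
    have "hausdorff_pre s \<delta> (A i) < top"
      using ennreal_suminf_lessD[OF fin, of i] by simp
    then have "hausdorff_pre s \<delta> (A i) + 0 < hausdorff_pre s \<delta> (A i) + ennreal (e * (1/2) ^ Suc i)"
      using e by (subst ennreal_add_left_cancel_less) auto
    then have "hausdorff_pre s \<delta> (A i) < hausdorff_pre s \<delta> (A i) + ennreal (e * (1/2) ^ Suc i)"
      by (simp only: add_0_right)
    from hausdorff_pre_near_cover[OF this] obtain C :: "nat \<Rightarrow> 'a set" where "A i \<subseteq> (\<Union>j. C j)"
      "\<And>j. bounded (C j)" "\<And>j. diameter (C j) \<le> \<delta>"
      "(\<Sum>j. ennreal (diameter (C j) powr s)) < hausdorff_pre s \<delta> (A i) + ennreal (e * (1/2) ^ Suc i)"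
      by blast
    then show ?thesis by (intro exI[of _ C]) (simp add: less_imp_le)
  qed
  then have "\<forall>i. \<exists>C. A i \<subseteq> (\<Union>j. C j) \<and> (\<forall>j. bounded (C j) \<and> diameter (C j) \<le> \<delta>) \<and>
      (\<Sum>j. ennreal (diameter (C j :: 'a set) powr s)) \<le> hausdorff_pre s \<delta> (A i) + ennreal (e * (1/2) ^ Suc i)"
    by (rule allI)
  from choice[OF this] obtain C where C': "\<forall>i. A i \<subseteq> (\<Union>j. C i j) \<and>
      (\<forall>j. bounded (C i j) \<and> diameter (C i j) \<le> \<delta>) \<and>
      (\<Sum>j. ennreal (diameter (C i j :: 'a set) powr s)) \<le> hausdorff_pre s \<delta> (A i) + ennreal (e * (1/2) ^ Suc i)"
    by blast
  have C: "A i \<subseteq> (\<Union>j. C i j)" "bounded (C i j)" "diameter (C i j) \<le> \<delta>"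
      "(\<Sum>j. ennreal (diameter (C i j) powr s)) \<le> hausdorff_pre s \<delta> (A i) + ennreal (e * (1/2) ^ Suc i)" for i j
    using spec[OF C', of i] by blast+
  let ?D = "\<lambda>(i, j). C i j"
  have "hausdorff_pre s \<delta> (\<Union>i. A i) \<le> (\<Sum>n. ennreal (diameter (?D (prod_decode n)) powr s))"
  proof (rule hausdorff_pre_le)
    show "(\<Union>i. A i) \<subseteq> (\<Union>n. ?D (prod_decode n))"
    proof
      fix x assume "x \<in> (\<Union>i. A i)"
      then obtain i j where "x \<in> C i j" using C(1) by blast
      then have "x \<in> ?D (prod_decode (prod_encode (i, j)))" by simp
      then show "x \<in> (\<Union>n. ?D (prod_decode n))" by (rule UN_I[OF UNIV_I])
    qed
  qed (auto simp: C(2,3) split: prod.split)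
  also have "\<dots> = (\<Sum>i. \<Sum>j. ennreal (diameter (C i j) powr s))"
    by (rule suminf_ennreal_2dimen[where f = "\<lambda>p. ennreal (diameter (?D p) powr s)"]) simp
  also have "\<dots> \<le> (\<Sum>i. hausdorff_pre s \<delta> (A i) + ennreal (e * (1/2) ^ Suc i))"
    by (intro suminf_le C(4)) auto
  also have "\<dots> = (\<Sum>i. hausdorff_pre s \<delta> (A i)) + (\<Sum>i. ennreal (e * (1/2) ^ Suc i))"
    by (intro suminf_add[symmetric]) auto
  also have "(\<Sum>i. ennreal (e * (1/2) ^ Suc i)) = ennreal e"
    using sums_mult[OF power_half_series, of e] e by (intro suminf_ennreal_eq) auto
  finally show "hausdorff_pre s \<delta> (\<Union>i. A i) \<le> (\<Sum>i. hausdorff_pre s \<delta> (A i)) + ennreal e" .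
qed

lemma hausdorff_UN_le:
  "hausdorff s (\<Union>i::nat. A i) \<le> (\<Sum>i. hausdorff s (A i))"
proof (rule hausdorff_leI)
  fix \<delta> :: real assume "0 < \<delta>"
  then show "hausdorff_pre s \<delta> (\<Union>i. A i) \<le> (\<Sum>i. hausdorff s (A i))"
    by (intro order_trans[OF hausdorff_pre_UN_le] suminf_le hausdorff_pre_le_hausdorff) auto
qed

lemma outer_measure_space_hausdorff: "outer_measure_space UNIV (hausdorff s)"
  by (auto simp: outer_measure_space_def positive_def increasing_def countably_subadditive_def
      hausdorff_mono hausdorff_UN_le)

lemma hausdorff_Un_le: "hausdorff s (A \<union> B) \<le> hausdorff s A + hausdorff s B"
proof -
  have "subadditive UNIV (hausdorff s)"
    by (metis outer_measure_space_def outer_measure_space_hausdorff Pow_UNIV sigma_algebra_Pow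
        ring_of_sets.countably_subadditive_subadditive algebra.axioms(1) sigma_algebra.axioms(1))
  \<comment> \<open>\<open>subadditive\<close> concerns disjoint sets, hence \<open>B - A\<close> in
    place of \<open>B\<close>.\<close>
  then have "hausdorff s (A \<union> (B - A)) \<le> hausdorff s A + hausdorff s (B - A)"
    by (intro subadditiveD) auto
  also have "\<dots> \<le> hausdorff s A + hausdorff s B"
    by (intro add_mono hausdorff_mono) auto
  finally show ?thesis by simp
qed

lemma hausdorff_le_sum3:
  assumes "A \<subseteq> B \<union> C \<union> D"
  shows "hausdorff s A \<le> hausdorff s B + hausdorff s C + hausdorff s D"
proof -
  have "hausdorff s A \<le> hausdorff s (B \<union> C \<union> D)" using assms by (rule hausdorff_mono)
  also have "\<dots> \<le> hausdorff s (B \<union> C) + hausdorff s D" by (rule hausdorff_Un_le)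
  also have "\<dots> \<le> hausdorff s B + hausdorff s C + hausdorff s D"
    by (intro add_right_mono hausdorff_Un_le)
  finally show ?thesis .
qed

lemma hausdorff_null_UN:
  assumes "countable I" "\<And>i. i \<in> I \<Longrightarrow> hausdorff s (A i) = 0"
  shows "hausdorff s (\<Union>i\<in>I. A i) = 0"
proof (cases "I = {}")
  case False
  have "(\<Union>i\<in>I. A i) = (\<Union>n. A (from_nat_into I n))"
    using range_from_nat_into[OF False assms(1)] by force
  moreover have "hausdorff s (\<Union>n. A (from_nat_into I n)) \<le> (\<Sum>n. hausdorff s (A (from_nat_into I n)))"
    by (rule hausdorff_UN_le)
  ultimately show ?thesis using assms False by (simp add: from_nat_into)
qed simp

lemma hausdorff_null_subset: "hausdorff s B = 0 \<Longrightarrow> A \<subseteq> B \<Longrightarrow> hausdorff s A = 0"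
  using hausdorff_mono by (metis le_zero_eq)

lemma hausdorff_null_Un: "hausdorff s A = 0 \<Longrightarrow> hausdorff s B = 0 \<Longrightarrow> hausdorff s (A \<union> B) = 0"
  using hausdorff_Un_le[of s A B] by simp

section \<open>Additivity over separated sets and Caratheodory measurability\<close>

text \<open>A covering set of diameter at most \<open>\<delta>\<close> is too small to meet both
  \<open>A\<close> and \<open>B\<close>, so every cover of the union splits into a cover of each at
  no extra cost.\<close>

lemma hausdorff_pre_add_le_of_separated:
  fixes A B :: "'a::metric_space set"
  assumes "0 \<le> s" "\<delta> < \<eta>" and sep: "\<And>x y. x \<in> A \<Longrightarrow> y \<in> B \<Longrightarrow> \<eta> \<le> dist x y"
  shows "hausdorff_pre s \<delta> A + hausdorff_pre s \<delta> B \<le> hausdorff_pre s \<delta> (A \<union> B)"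
  unfolding hausdorff_pre_def[of s \<delta> "A \<union> B"]
proof (rule INF_greatest, clarsimp)
  fix C :: "nat \<Rightarrow> 'a set"
  assume A: "A \<subseteq> (\<Union>i. C i)" and B: "B \<subseteq> (\<Union>i. C i)"
    and C: "\<forall>i. bounded (C i) \<and> diameter (C i) \<le> \<delta>"
  have b: "bounded (C i \<inter> E)" for i E using C by (meson bounded_subset inf_le1)
  have d: "diameter (C i \<inter> E) \<le> diameter (C i)" for i E using C by (intro diameter_subset) auto
  have d': "diameter (C i \<inter> E) \<le> \<delta>" for i E using C d by (meson order_trans)
  have "hausdorff_pre s \<delta> A + hausdorff_pre s \<delta> B
    \<le> (\<Sum>i. ennreal (diameter (C i \<inter> A) powr s)) + (\<Sum>i. ennreal (diameter (C i \<inter> B) powr s))"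
    using A B d' b by (intro add_mono hausdorff_pre_le) auto
  also have "\<dots> = (\<Sum>i. ennreal (diameter (C i \<inter> A) powr s) + ennreal (diameter (C i \<inter> B) powr s))"
    by (intro suminf_add) auto
  also have "\<dots> \<le> (\<Sum>i. ennreal (diameter (C i) powr s))"
  proof (intro suminf_le)
    fix i
    have "C i \<inter> A = {} \<or> C i \<inter> B = {}"
    proof (rule ccontr)
      assume "\<not> ?thesis"
      then obtain x y where xy: "x \<in> C i" "x \<in> A" "y \<in> C i" "y \<in> B" by auto
      then have "dist x y \<le> diameter (C i)" using C by (intro diameter_bounded_bound) auto
      also have "\<dots> < \<eta>" using C assms(2) by (meson le_less_trans)
      finally show False using sep xy by force
    qed
    \<comment> \<open>One of the two intersections is empty and costs nothing, since the empty set
      has diameter \<open>0\<close> and \<open>0 powr s = 0\<close>.\<close>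
    then show "ennreal (diameter (C i \<inter> A) powr s) + ennreal (diameter (C i \<inter> B) powr s)
        \<le> ennreal (diameter (C i) powr s)"
      using d b assms(1) by (auto intro!: ennreal_leI powr_mono2 diameter_ge_0)
  qed auto
  finally show "hausdorff_pre s \<delta> A + hausdorff_pre s \<delta> B \<le> (\<Sum>i. ennreal (diameter (C i) powr s))" .
qed

text \<open>The scales for \<open>A\<close> and \<open>B\<close> vary independently, so that the two
  suprema can be taken one after the other. Passing to a common scale below \<open>\<eta>\<close>
  only increases both premeasures.\<close>

lemma hausdorff_add_le_of_separated:
  fixes A B :: "'a::metric_space set"
  assumes "0 \<le> s" "0 < \<eta>" and sep: "\<And>x y. x \<in> A \<Longrightarrow> y \<in> B \<Longrightarrow> \<eta> \<le> dist x y"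
  shows "hausdorff s A + hausdorff s B \<le> hausdorff s (A \<union> B)"
proof -
  have *: "hausdorff_pre s \<delta> A + hausdorff_pre s \<delta>' B \<le> hausdorff s (A \<union> B)"
    if "0 < \<delta>" "0 < \<delta>'" for \<delta> \<delta>'
  proof -
    define \<epsilon> where "\<epsilon> = min (min \<delta> \<delta>') (\<eta> / 2)"
    have "hausdorff_pre s \<delta> A + hausdorff_pre s \<delta>' B \<le> hausdorff_pre s \<epsilon> A + hausdorff_pre s \<epsilon> B"
      by (intro add_mono hausdorff_pre_antimono) (auto simp: \<epsilon>_def)
    also have "\<dots> \<le> hausdorff_pre s \<epsilon> (A \<union> B)"
      using assms by (intro hausdorff_pre_add_le_of_separated[where \<eta>=\<eta>]) (auto simp: \<epsilon>_def)
    also have "\<dots> \<le> hausdorff s (A \<union> B)"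
      using that assms by (intro hausdorff_pre_le_hausdorff) (auto simp: \<epsilon>_def)
    finally show ?thesis .
  qed
  have "hausdorff s A + hausdorff_pre s \<delta>' B \<le> hausdorff s (A \<union> B)" if "0 < \<delta>'" for \<delta>'
    unfolding hausdorff_def[of s A] using *[OF _ that]
    by (subst ennreal_SUP_add_left[symmetric]) (auto intro!: SUP_least)
  then show ?thesis
    unfolding hausdorff_def[of s B]
    by (subst ennreal_SUP_add_right) (auto intro!: SUP_least)
qed

text \<open>The sets are joined one at a time, each step using its own gap, so the gaps may shrink
  as the index grows.\<close>

lemma sum_hausdorff_le_of_separated:
  fixes D :: "nat \<Rightarrow> 'a::metric_space set"
  assumes "0 \<le> s" and sub: "\<And>n. D n \<subseteq> A"
    and sep: "\<And>n. \<exists>\<eta>>0. \<forall>m<n. \<forall>x\<in>D m. \<forall>y\<in>D n. \<eta> \<le> dist x y"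
  shows "(\<Sum>i<n. hausdorff s (D i)) \<le> hausdorff s A"
proof -
  have "(\<Sum>i<n. hausdorff s (D i)) \<le> hausdorff s (\<Union>i<n. D i)"
  proof (induction n)
    case (Suc n)
    obtain \<eta> where \<eta>: "\<eta> > 0" "\<And>m x y. m < n \<Longrightarrow> x \<in> D m \<Longrightarrow> y \<in> D n \<Longrightarrow> \<eta> \<le> dist x y"
      using sep[of n] by auto
    have "(\<Sum>i<Suc n. hausdorff s (D i)) \<le> hausdorff s (\<Union>i<n. D i) + hausdorff s (D n)"
      using Suc by (auto intro: add_mono)
    also have "\<dots> \<le> hausdorff s ((\<Union>i<n. D i) \<union> D n)"
      using \<eta> assms(1) by (intro hausdorff_add_le_of_separated[where \<eta>=\<eta>]) auto
    finally show ?case by (simp add: lessThan_Suc Un_commute)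
  qed simp
  also have "\<dots> \<le> hausdorff s A" using sub by (intro hausdorff_mono) auto
  finally show ?thesis .
qed

lemma tendsto_zero_suminf_tail:
  fixes g :: "nat \<Rightarrow> ennreal"
  assumes "(\<Sum>i. g i) \<noteq> top"
  shows "(\<lambda>n. \<Sum>i. g (i + n)) \<longlonglongrightarrow> 0"
proof -
  have "g i < top" for i
    using assms ennreal_suminf_lessD[of g top i] by (simp add: top.not_eq_extremum)
  then have g: "g i = ennreal (enn2real (g i))" for i by simp
  have sm: "summable (\<lambda>i. enn2real (g i))"
    by (rule summable_suminf_not_top) (use assms g in auto)
  have "(\<Sum>i. g (i + n)) = ennreal (\<Sum>i. enn2real (g (i + n)))" for n
    using sm by (subst g, intro suminf_ennreal2) (auto simp: summable_iff_shift[where f = "\<lambda>i. enn2real (g i)"])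
  then show ?thesis
    using tendsto_ennrealI[OF suminf_exist_split2[OF sm]] by simp
qed

text \<open>Caratheodory's criterion for metric outer measures. The layers \<open>D n\<close> of points at distance
  about \<open>1 / n\<close> from the complement of the open set are separated as soon as their indices
  differ by at least two, which makes the sum of their measures finite.\<close>

lemma hausdorff_Caratheodory_open:
  fixes A U :: "'a::metric_space set"
  assumes s: "0 \<le> s" and U: "open U"
  shows "hausdorff s (A \<inter> U) + hausdorff s (A - U) = hausdorff s A"
proof (rule antisym)
  have "A \<inter> U \<union> (A - U) = A" by auto
  then show "hausdorff s A \<le> hausdorff s (A \<inter> U) + hausdorff s (A - U)"
    by (metis hausdorff_Un_le)
  show "hausdorff s (A \<inter> U) + hausdorff s (A - U) \<le> hausdorff s A"
  proof (cases "hausdorff s A = top \<or> -U = {}")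
    case True
    then show ?thesis by (cases "-U = {}") (auto simp: Diff_eq intro: hausdorff_mono)
  next
    case False
    then have fin: "hausdorff s A < top" and ne: "-U \<noteq> {}" by (auto simp: top.not_eq_extremum)
    \<comment> \<open>\<open>infdist\<close> to the empty set is \<open>0\<close> by convention,
      which is why the case of empty \<open>-U\<close> has been split off.\<close>
    define E where "E n = {x \<in> A. 1 / real (Suc n) \<le> infdist x (-U)}" for n
    define D where "D n = E (Suc n) - E n" for n
    have EU: "E n \<subseteq> A \<inter> U" for n
    proof
      fix x assume "x \<in> E n"
      then have "0 < infdist x (-U)" "x \<in> A"
        by (auto simp: E_def intro: less_le_trans[of _ "1 / real (Suc n)"])
      then show "x \<in> A \<inter> U" using infdist_zero[of x "-U"] by (cases "x \<in> U") auto
    qed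
    have Emono: "E m \<subseteq> E n" if "m \<le> n" for m n
    proof -
      have "1 / real (Suc n) \<le> 1 / real (Suc m)" using that by (intro frac_le) auto
      then show ?thesis by (auto simp: E_def)
    qed
    \<comment> \<open>Points of \<open>D (Suc n)\<close> lie outside \<open>E (Suc n)\<close>. Their
      \<open>infdist\<close> is thus smaller than on \<open>E n\<close> by at least the stated gap,
      and \<open>infdist\<close> is 1-Lipschitz.\<close>
    have sepDE: "\<exists>\<eta>>0. \<forall>m\<le>n. \<forall>x\<in>E m. \<forall>y\<in>D (Suc n). \<eta> \<le> dist x y" for n
    proof (intro exI[of _ "1 / real (Suc n) - 1 / real (Suc (Suc n))"] conjI allI impI ballI)
      fix m x y assume "m \<le> n" "x \<in> E m" and y: "y \<in> D (Suc n)"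
      then have "x \<in> E n" using Emono by blast
      then show "1 / real (Suc n) - 1 / real (Suc (Suc n)) \<le> dist x y"
        using y infdist_triangle[of x "-U" y] by (auto simp: E_def D_def)
    qed (auto simp: field_simps intro!: add_pos_nonneg)
    \<comment> \<open>The values \<open>0\<close> and \<open>1\<close> of \<open>c\<close> select
      the even and the odd layers.\<close>
    have sumD: "(\<Sum>i<n. hausdorff s (D (2 * i + c))) \<le> hausdorff s A" for n c
    proof (intro sum_hausdorff_le_of_separated s)
      show "D (2 * n + c) \<subseteq> A" for n by (auto simp: D_def E_def)
      show "\<exists>\<eta>>0. \<forall>m<n. \<forall>x\<in>D (2 * m + c). \<forall>y\<in>D (2 * n + c). \<eta> \<le> dist x y" for n
      proof (cases n)
        case 0
        then show ?thesis by (auto intro: exI[of _ 1])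
      next
        case (Suc k)
        obtain \<eta> where "\<eta> > 0"
          "\<forall>m\<le>2 * k + 1 + c. \<forall>x\<in>E m. \<forall>y\<in>D (Suc (2 * k + 1 + c)). \<eta> \<le> dist x y"
          using sepDE by blast
        moreover have "D (2 * m + c) \<subseteq> E (2 * k + 1 + c)" if "m < n" for m
          using that Suc Emono[of "Suc (2 * m + c)" "2 * k + 1 + c"] by (auto simp: D_def)
        ultimately show ?thesis using Suc by (intro exI[of _ \<eta>]) auto
      qed
    qed
    have "(\<Sum>i<n. hausdorff s (D i)) \<le> hausdorff s A + hausdorff s A" for n
    proof -
      have "(\<Sum>i<n. hausdorff s (D i)) \<le> (\<Sum>i<2 * n. hausdorff s (D i))"
        by (intro sum_mono2) auto
      also have "\<dots> = (\<Sum>i<n. hausdorff s (D (2 * i + 0))) + (\<Sum>i<n. hausdorff s (D (2 * i + 1)))"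
        by (induction n) (auto simp: ac_simps)
      also have "\<dots> \<le> hausdorff s A + hausdorff s A"
        by (intro add_mono sumD)
      finally show ?thesis .
    qed
    then have "(\<Sum>i. hausdorff s (D i)) \<le> hausdorff s A + hausdorff s A"
      by (intro suminf_le_const) auto
    then have finD: "(\<Sum>i. hausdorff s (D i)) \<noteq> top"
      using fin by (metis ennreal_add_less_top leD top.not_eq_extremum)
    have decomp: "A \<inter> U \<subseteq> E n \<union> (\<Union>i. D (i + n))" for n
    proof
      fix x assume x: "x \<in> A \<inter> U"
      then have "0 < infdist x (-U)"
        using U ne by (metis Compl_iff IntD2 closed_Compl in_closed_iff_infdist_zero infdist_nonneg less_eq_real_def)
      then obtain k where "1 / real (Suc k) < infdist x (-U)" by (rule nat_approx_posE)
      then have k: "x \<in> E k" using x by (auto simp: E_def)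
      show "x \<in> E n \<union> (\<Union>i. D (i + n))"
      proof (cases "x \<in> E n")
        case False
        define l where "l = (LEAST k. x \<in> E k)"
        have l: "x \<in> E l" using k unfolding l_def by (rule LeastI)
        have "n < l" using False l Emono[of l n] by (meson not_le subsetD)
        then obtain j where j: "l = Suc j" "n \<le> j" by (metis Suc_le_D Suc_le_mono less_eq_Suc_le)
        then have "x \<notin> E j" using not_less_Least[of j "\<lambda>k. x \<in> E k"] by (auto simp: l_def)
        then have "x \<in> D (j - n + n)" using l j by (auto simp: D_def)
        then show ?thesis by blast
      qed auto
    qed
    \<comment> \<open>\<open>E n\<close> has positive distance from \<open>A - U\<close>, so
      additivity is lost only on the tail of layers, which tends to \<open>0\<close>.\<close>
    have step: "hausdorff s (A \<inter> U) + hausdorff s (A - U) \<le> hausdorff s A + (\<Sum>i. hausdorff s (D (i + n)))" for n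
    proof -
      have "hausdorff s (A \<inter> U) \<le> hausdorff s (E n) + (\<Sum>i. hausdorff s (D (i + n)))"
        by (intro order_trans[OF hausdorff_mono[OF decomp[of n]]] order_trans[OF hausdorff_Un_le]
            add_mono hausdorff_UN_le order_refl)
      then have "hausdorff s (A \<inter> U) + hausdorff s (A - U)
          \<le> (hausdorff s (E n) + hausdorff s (A - U)) + (\<Sum>i. hausdorff s (D (i + n)))"
        by (metis add.commute add.left_commute add_left_mono)
      also have "hausdorff s (E n) + hausdorff s (A - U) \<le> hausdorff s (E n \<union> (A - U))"
      proof (intro hausdorff_add_le_of_separated[where \<eta>="1 / real (Suc n)"] s)
        fix x y assume "x \<in> E n" "y \<in> A - U"
        then show "1 / real (Suc n) \<le> dist x y"
          using infdist_le[of y "-U" x] by (auto simp: E_def)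
      qed auto
      also have "\<dots> \<le> hausdorff s A" using EU[of n] by (intro hausdorff_mono) auto
      finally show ?thesis by (simp add: add_right_mono)
    qed
    have "(\<lambda>n. \<Sum>i. hausdorff s (D (i + n))) \<longlonglongrightarrow> 0"
      using finD by (rule tendsto_zero_suminf_tail)
    then have "(\<lambda>n. hausdorff s A + (\<Sum>i. hausdorff s (D (i + n)))) \<longlonglongrightarrow> hausdorff s A + 0"
      by (intro tendsto_intros)
    then show ?thesis using step by (intro tendsto_lowerbound) auto
  qed
qed

text \<open>The Caratheodory-measurable sets form a sigma-algebra, and the preceding criterion puts
  the open sets into it.\<close>

lemma borel_subset_lambda_system_hausdorff:
  assumes "0 \<le> s"
  shows "sets (borel :: 'a::metric_space measure) \<subseteq> lambda_system UNIV UNIV (hausdorff s)"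
proof -
  interpret sigma_algebra "UNIV :: 'a set" "UNIV :: 'a set set"
    by (metis Pow_UNIV sigma_algebra_Pow)
  have "sigma_algebra (UNIV :: 'a set) (lambda_system UNIV UNIV (hausdorff s))"
    using caratheodory_lemma[OF outer_measure_space_hausdorff] by (simp add: measure_space_def)
  moreover have "{S :: 'a set. open S} \<subseteq> lambda_system UNIV UNIV (hausdorff s)"
    by (auto simp: lambda_system_eq hausdorff_Caratheodory_open[OF assms])
  ultimately show ?thesis
    unfolding borel_def by (simp add: sigma_algebra.sigma_sets_subset)
qed

section \<open>The Hausdorff measure on Borel sets\<close>

text \<open>Restricting to Borel sets gives access to continuity from above and to the Lebesgue
  integral.\<close>

definition hausdorff_measure :: "real \<Rightarrow> 'a::metric_space measure" where
  "hausdorff_measure s = measure_of UNIV (sets borel) (hausdorff s)"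

lemma sets_hausdorff_measure [simp, measurable_cong]: "sets (hausdorff_measure s) = sets borel"
  using sets.sigma_sets_eq[of borel] by (simp add: hausdorff_measure_def)

lemma space_hausdorff_measure [simp]: "space (hausdorff_measure s) = UNIV"
  by (simp add: hausdorff_measure_def)

lemma emeasure_hausdorff_measure:
  fixes A :: "'a::metric_space set"
  assumes "0 \<le> s" "A \<in> sets borel"
  shows "emeasure (hausdorff_measure s) A = hausdorff s A"
proof -
  interpret sigma_algebra "UNIV :: 'a set" "UNIV :: 'a set set"
    by (metis Pow_UNIV sigma_algebra_Pow)
  have "measure_space (UNIV :: 'a set) (sets borel) (hausdorff s)"
    using measure_down[OF caratheodory_lemma[OF outer_measure_space_hausdorff]
        _ borel_subset_lambda_system_hausdorff[OF assms(1)]]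
    by (metis sets.sigma_algebra_axioms space_borel)
  then show ?thesis
    unfolding hausdorff_measure_def using assms
    by (intro emeasure_measure_of_sigma) (auto simp: measure_space_def)
qed

lemma hausdorff_Caratheodory:
  fixes A B :: "'a::metric_space set"
  assumes "0 \<le> s" "B \<in> sets borel"
  shows "hausdorff s A = hausdorff s (A \<inter> B) + hausdorff s (A - B)"
proof -
  interpret sigma_algebra "UNIV :: 'a set" "UNIV :: 'a set set"
    by (metis Pow_UNIV sigma_algebra_Pow)
  show ?thesis
    using borel_subset_lambda_system_hausdorff[OF assms(1), where 'a='a] assms(2)
    by (auto simp: lambda_system_eq)
qed

text \<open>Caratheodory's identity cuts the pieces off \<open>A\<close> one after the other. It
  splits arbitrary sets, so this also applies to sets such as \<open>close_fibre\<close> that are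
  not known to be Borel.\<close>

lemma sum_hausdorff_Int_le:
  fixes A :: "'a::metric_space set"
  assumes "0 \<le> s" "finite I" "\<And>i. i \<in> I \<Longrightarrow> B i \<in> sets borel" "disjoint_family_on B I"
  shows "(\<Sum>i\<in>I. hausdorff s (A \<inter> B i)) \<le> hausdorff s A"
  using assms(2-4)
proof (induction I arbitrary: A rule: finite_induct)
  case (insert i I)
  have disj: "(A - B i) \<inter> B j = A \<inter> B j" if "j \<in> I" for j
    using insert(2,5) that by (fastforce simp: disjoint_family_on_def)
  have "(\<Sum>j\<in>I. hausdorff s (A \<inter> B j)) = (\<Sum>j\<in>I. hausdorff s ((A - B i) \<inter> B j))"
    by (intro sum.cong) (auto simp: disj)
  also have "\<dots> \<le> hausdorff s (A - B i)"
    using insert by (intro insert(3)) (auto simp: disjoint_family_on_def)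
  finally show ?case
    using insert hausdorff_Caratheodory[OF assms(1), of "B i" A] by (simp add: add_left_mono)
qed simp

section \<open>Open neighbourhoods and hulls of null sets\<close>

text \<open>Thickening by a small \<open>\<eta>\<close> enlarges the diameter by at most
  \<open>2 * \<eta>\<close>, and continuity of the power controls the change in cost.\<close>

lemma open_superset_diameter:
  fixes C :: "'a::metric_space set"
  assumes "bounded C" "0 < s" "0 < \<delta>" "0 < e"
  obtains U where "open U" "C \<subseteq> U" "bounded U" "diameter U \<le> diameter C + \<delta>"
    "ennreal (diameter U powr s) \<le> ennreal (diameter C powr s) + ennreal e"
proof -
  \<comment> \<open>Positivity of \<open>s\<close> makes the power continuous also when
    \<open>diameter C = 0\<close>.\<close>
  have "((\<lambda>\<eta>. (diameter C + 2 * \<eta>) powr s) \<longlongrightarrow> (diameter C + 2 * 0) powr s) (at_right 0)"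
    using \<open>0 < s\<close> diameter_ge_0[OF \<open>bounded C\<close>]
    by (intro tendsto_powr' tendsto_intros) (auto simp: eventually_at_right_less eventually_at_right_field intro!: exI[of _ 1])
  then have "\<forall>\<^sub>F \<eta> in at_right 0. (diameter C + 2 * \<eta>) powr s < diameter C powr s + e"
    using \<open>0 < e\<close> by (intro order_tendstoD) auto
  moreover have "\<forall>\<^sub>F \<eta> in at_right 0. 0 < \<eta> \<and> \<eta> < \<delta> / 2"
    using \<open>0 < \<delta>\<close> by (auto simp: eventually_at_right_field intro!: exI[of _ "\<delta> / 2"])
  ultimately have "\<forall>\<^sub>F \<eta> in at_right 0. (diameter C + 2 * \<eta>) powr s < diameter C powr s + e \<and> 0 < \<eta> \<and> \<eta> < \<delta> / 2"
    by eventually_elim simp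
  then obtain \<eta> where \<eta>: "(diameter C + 2 * \<eta>) powr s < diameter C powr s + e" "0 < \<eta>" "\<eta> < \<delta> / 2"
    using eventually_happens'[OF trivial_limit_at_right_real] by blast
  define U where "U = (\<Union>x\<in>C. ball x \<eta>)"
  have dU: "dist y z \<le> diameter C + 2 * \<eta>" if yz: "y \<in> U" "z \<in> U" for y z
  proof -
    obtain y' z' where *: "y' \<in> C" "z' \<in> C" "dist y' y < \<eta>" "dist z' z < \<eta>"
      using yz by (auto simp: U_def)
    then have "dist y' z' \<le> diameter C" using \<open>bounded C\<close> by (intro diameter_bounded_bound)
    then show ?thesis using * dist_triangle[of y z z'] dist_triangle[of y z' y'] by (simp add: dist_commute)
  qed
  have le: "diameter U \<le> diameter C + 2 * \<eta>"
    using dU \<eta> diameter_ge_0[OF \<open>bounded C\<close>] by (intro diameter_leI) auto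
  have bU: "bounded U" using dU by (rule boundedI_dist)
  show ?thesis
  proof (rule that)
    show "open U" "C \<subseteq> U" using \<eta> by (auto simp: U_def)
    show "diameter U \<le> diameter C + \<delta>" using le \<eta> by simp
    have "diameter U powr s \<le> (diameter C + 2 * \<eta>) powr s"
      using le \<open>0 < s\<close> by (intro powr_mono2 diameter_ge_0 bU) auto
    then have "ennreal (diameter U powr s) \<le> ennreal (diameter C powr s + e)"
      using \<eta> by (intro ennreal_leI) auto
    then show "ennreal (diameter U powr s) \<le> ennreal (diameter C powr s) + ennreal e"
      using \<open>0 < e\<close> by simp
  qed (rule bU)
qed

text \<open>A cover at scale \<open>\<delta>/2\<close> with sum below \<open>\<delta>/2\<close>
  leaves half of the scale and half of the bound for making the covering sets open.\<close>

lemma hausdorff_null_open_cover: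
  fixes W :: "'a::metric_space set"
  assumes "0 < s" "hausdorff s W = 0" "0 < \<delta>"
  obtains U where "open U" "W \<subseteq> U" "hausdorff_pre s \<delta> U \<le> ennreal \<delta>"
proof -
  have "hausdorff_pre s (\<delta>/2) W < ennreal (\<delta>/2)"
    using hausdorff_pre_le_hausdorff[of "\<delta>/2" s W] assms by simp
  then obtain C :: "nat \<Rightarrow> 'a set" where C: "W \<subseteq> (\<Union>i. C i)" "\<And>i. bounded (C i)"
    "\<And>i. diameter (C i) \<le> \<delta>/2" "(\<Sum>i. ennreal (diameter (C i) powr s)) < ennreal (\<delta>/2)"
    by (rule hausdorff_pre_near_cover) blast
  have "\<forall>i. \<exists>U. open U \<and> C i \<subseteq> U \<and> bounded U \<and> diameter U \<le> diameter (C i) + \<delta>/2 \<and>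
    ennreal (diameter U powr s) \<le> ennreal (diameter (C i) powr s) + ennreal (\<delta>/2 * (1/2) ^ Suc i)"
  proof
    fix i
    have "0 < \<delta>/2" "0 < \<delta>/2 * (1/2) ^ Suc i" using assms by auto
    from open_superset_diameter[OF C(2)[of i] assms(1) this] obtain V where "open V" "C i \<subseteq> V" "bounded V"
      "diameter V \<le> diameter (C i) + \<delta>/2"
      "ennreal (diameter V powr s) \<le> ennreal (diameter (C i) powr s) + ennreal (\<delta>/2 * (1/2) ^ Suc i)" .
    then show "\<exists>U. open U \<and> C i \<subseteq> U \<and> bounded U \<and> diameter U \<le> diameter (C i) + \<delta>/2 \<and>
      ennreal (diameter U powr s) \<le> ennreal (diameter (C i) powr s) + ennreal (\<delta>/2 * (1/2) ^ Suc i)"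
      by (intro exI[of _ V] conjI)
  qed
  from choice[OF this] obtain U where U: "\<forall>i. open (U i) \<and> C i \<subseteq> U i \<and> bounded (U i)
      \<and> diameter (U i) \<le> diameter (C i) + \<delta>/2 \<and>
    ennreal (diameter (U i) powr s) \<le> ennreal (diameter (C i) powr s) + ennreal (\<delta>/2 * (1/2) ^ Suc i)"
    by blast
  have dU: "diameter (U i) \<le> \<delta>" for i
    using U[rule_format, of i] C(3)[of i] by linarith
  have "hausdorff_pre s \<delta> (\<Union>i. U i) \<le> (\<Sum>i. ennreal (diameter (U i) powr s))"
    using U dU by (intro hausdorff_pre_le) auto
  also have "\<dots> \<le> (\<Sum>i. ennreal (diameter (C i) powr s) + ennreal (\<delta>/2 * (1/2) ^ Suc i))"
    by (intro suminf_le U[rule_format, THEN conjunct2, THEN conjunct2, THEN conjunct2, THEN conjunct2]) auto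
  also have "\<dots> = (\<Sum>i. ennreal (diameter (C i) powr s)) + (\<Sum>i. ennreal (\<delta>/2 * (1/2) ^ Suc i))"
    by (intro suminf_add[symmetric]) auto
  also have "(\<Sum>i. ennreal (\<delta>/2 * (1/2) ^ Suc i)) = ennreal (\<delta>/2)"
    using sums_mult[OF power_half_series, of "\<delta>/2"] assms by (intro suminf_ennreal_eq) auto
  also have "(\<Sum>i. ennreal (diameter (C i) powr s)) + ennreal (\<delta>/2) \<le> ennreal (\<delta>/2) + ennreal (\<delta>/2)"
    using C(4) by (intro add_right_mono less_imp_le)
  also have "\<dots> = ennreal \<delta>" using assms by (simp flip: ennreal_plus)
  finally have "hausdorff_pre s \<delta> (\<Union>i. U i) \<le> ennreal \<delta>" .
  moreover have "open (\<Union>i. U i)" using U by (intro open_UN) auto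
  moreover have "W \<subseteq> (\<Union>i. U i)"
    using C(1) by (rule order_trans) (intro UN_mono order_refl, simp add: U)
  ultimately show ?thesis by (intro that)
qed

text \<open>Intersects open supersets whose premeasure at scale \<open>1 / real (Suc n)\<close> is
  at most that same number. A null set can thus be enlarged to one whose preimage under a continuous
  map is again a G-delta set.\<close>

lemma hausdorff_null_G_delta_hull:
  fixes W :: "'a::metric_space set"
  assumes "0 < s" "hausdorff s W = 0"
  obtains U :: "nat \<Rightarrow> 'a set" where "\<And>n. open (U n)" "W \<subseteq> (\<Inter>n. U n)" "hausdorff s (\<Inter>n. U n) = 0"
proof -
  have "\<forall>n. \<exists>U. open U \<and> W \<subseteq> U \<and> hausdorff_pre s (1 / real (Suc n)) U \<le> ennreal (1 / real (Suc n))"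
  proof
    fix n
    have "0 < 1 / real (Suc n)" by simp
    from hausdorff_null_open_cover[OF assms this]
    show "\<exists>U. open U \<and> W \<subseteq> U \<and> hausdorff_pre s (1 / real (Suc n)) U \<le> ennreal (1 / real (Suc n))"
      by metis
  qed
  from choice[OF this] obtain U where U: "\<And>n. open (U n)" "\<And>n. W \<subseteq> U n"
    "\<And>n. hausdorff_pre s (1 / real (Suc n)) (U n) \<le> ennreal (1 / real (Suc n))"
    by blast
  have "hausdorff_pre s \<delta> (\<Inter>n. U n) \<le> 0" if "0 < \<delta>" for \<delta>
  proof (rule ennreal_le_epsilon)
    fix e :: real assume "0 < e"
    then have "0 < min \<delta> e" using that by simp
    then obtain n where n: "1 / real (Suc n) < min \<delta> e" by (rule nat_approx_posE)
    have "hausdorff_pre s \<delta> (\<Inter>n. U n) \<le> hausdorff_pre s (1 / real (Suc n)) (\<Inter>n. U n)"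
      using n by (intro hausdorff_pre_antimono) auto
    also have "\<dots> \<le> hausdorff_pre s (1 / real (Suc n)) (U n)"
      by (intro hausdorff_pre_mono) auto
    also have "\<dots> \<le> ennreal e" using n by (intro order_trans[OF U(3)] ennreal_leI) auto
    finally show "hausdorff_pre s \<delta> (\<Inter>n. U n) \<le> 0 + ennreal e" by simp
  qed
  then have "hausdorff s (\<Inter>n. U n) \<le> 0" by (rule hausdorff_leI)
  then show ?thesis using U(1,2) by (intro that[of U]) auto
qed

section \<open>Lipschitz images\<close>

text \<open>A cover at scale \<open>\<delta> / L\<close> is mapped to one at scale
  \<open>\<delta>\<close>, each cost growing by a factor of at most \<open>L powr s\<close>.\<close>

lemma hausdorff_lipschitz_image_le:
  fixes f :: "'a::metric_space \<Rightarrow> 'b::metric_space"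
  assumes "0 \<le> s" and L: "0 < L" and lip: "L-lipschitz_on A f"
  shows "hausdorff s (f ` A) \<le> ennreal (L powr s) * hausdorff s A"
proof (rule hausdorff_leI)
  fix \<delta> :: real assume "0 < \<delta>"
  have "hausdorff_pre s \<delta> (f ` A) \<le> ennreal (L powr s) * hausdorff_pre s (\<delta> / L) A"
  proof -
    \<comment> \<open>Dividing by the constant leaves the infimum alone on the right, so that each
      cover can be treated separately.\<close>
    have "hausdorff_pre s \<delta> (f ` A) / ennreal (L powr s) \<le> hausdorff_pre s (\<delta> / L) A"
      unfolding hausdorff_pre_def[of s "\<delta> / L"]
    proof (rule INF_greatest, clarsimp)
      fix C :: "nat \<Rightarrow> 'a set"
      assume A: "A \<subseteq> (\<Union>i. C i)" and C: "\<forall>i. bounded (C i) \<and> diameter (C i) \<le> \<delta> / L"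
      have dC: "dist u v \<le> L * diameter (C i)" if uv: "u \<in> f ` (A \<inter> C i)" "v \<in> f ` (A \<inter> C i)" for i u v
      proof -
        obtain x y where xy: "u = f x" "v = f y" "x \<in> A \<inter> C i" "y \<in> A \<inter> C i" using uv by auto
        then have "dist u v \<le> L * dist x y" using lip by (auto dest: lipschitz_onD)
        also have "\<dots> \<le> L * diameter (C i)"
          using xy C L by (intro mult_left_mono diameter_bounded_bound) auto
        finally show ?thesis .
      qed
      have b: "bounded (f ` (A \<inter> C i))" for i using dC by (rule boundedI_dist)
      have d: "diameter (f ` (A \<inter> C i)) \<le> L * diameter (C i)" for i
        using dC L C by (intro diameter_leI) (auto intro!: mult_nonneg_nonneg diameter_ge_0)
      have "L * diameter (C i) \<le> \<delta>" for i using C L by (simp add: field_simps)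
      then have "hausdorff_pre s \<delta> (f ` A) \<le> (\<Sum>i. ennreal (diameter (f ` (A \<inter> C i)) powr s))"
        using A b d by (intro hausdorff_pre_le) (fastforce intro: order_trans)+
      also have "\<dots> \<le> (\<Sum>i. ennreal (L powr s) * ennreal (diameter (C i) powr s))"
      proof (intro suminf_le)
        fix i
        have "diameter (f ` (A \<inter> C i)) powr s \<le> (L * diameter (C i)) powr s"
          using d b assms(1) by (intro powr_mono2 diameter_ge_0) auto
        also have "\<dots> = L powr s * diameter (C i) powr s"
          using L C by (intro powr_mult)
        finally show "ennreal (diameter (f ` (A \<inter> C i)) powr s) \<le> ennreal (L powr s) * ennreal (diameter (C i) powr s)"
          by (subst ennreal_mult[symmetric]) (auto intro: ennreal_leI)
      qed auto
      finally show "hausdorff_pre s \<delta> (f ` A) / ennreal (L powr s) \<le> (\<Sum>i. ennreal (diameter (C i) powr s))"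
        using L by (intro divide_le_posI_ennreal) auto
    qed
    then have "ennreal (L powr s) * (hausdorff_pre s \<delta> (f ` A) / ennreal (L powr s)) \<le> ennreal (L powr s) * hausdorff_pre s (\<delta> / L) A"
      by (intro mult_left_mono) auto
    then show ?thesis using L
      by (simp add: ennreal_times_divide mult.commute[of "ennreal (L powr s)"] mult_divide_eq_ennreal)
  qed
  also have "\<dots> \<le> ennreal (L powr s) * hausdorff s A"
    using L \<open>0 < \<delta>\<close> by (intro mult_left_mono hausdorff_pre_le_hausdorff) auto
  finally show "hausdorff_pre s \<delta> (f ` A) \<le> ennreal (L powr s) * hausdorff s A" .
qed

section \<open>Density points\<close>

text \<open>The basic \<open>5r\<close>-covering lemma. Balls are represented by pairs of centre and radius. Zorn's lemma
  is applied to the disjoint subfamilies that contain, for every ball they meet, a ball of at least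
  half its radius meeting it.\<close>

lemma Vitali_5r_covering:
  fixes B :: "('a::metric_space \<times> real) set"
  assumes B: "\<And>x r. (x, r) \<in> B \<Longrightarrow> 0 < r \<and> r \<le> R"
  obtains D where "D \<subseteq> B" "disjoint_family_on (\<lambda>p. ball (fst p) (snd p)) D"
    "\<And>x r. (x, r) \<in> B \<Longrightarrow> \<exists>p\<in>D. ball x r \<subseteq> ball (fst p) (5 * snd p)"
proof -
  define b where "b p = ball (fst p) (snd p)" for p :: "'a \<times> real"
  define \<A> where "\<A> = {D. D \<subseteq> B \<and> disjoint_family_on b D \<and>
    (\<forall>p\<in>B. (\<exists>q\<in>D. b p \<inter> b q \<noteq> {}) \<longrightarrow> (\<exists>q\<in>D. b p \<inter> b q \<noteq> {} \<and> snd p \<le> 2 * snd q))}"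
  have "\<exists>M\<in>\<A>. \<forall>X\<in>\<A>. M \<subseteq> X \<longrightarrow> X = M"
  proof (rule subset_Zorn')
    fix \<C> assume ch: "subset.chain \<A> \<C>"
    then have sub: "\<C> \<subseteq> \<A>" by (auto simp: subset.chain_def)
    have "disjoint_family_on b (\<Union>\<C>)"
      unfolding disjoint_family_on_def
    proof (intro ballI impI)
      fix p q assume "p \<in> \<Union>\<C>" "q \<in> \<Union>\<C>" and ne: "p \<noteq> q"
      then obtain P Q where PQ: "P \<in> \<C>" "Q \<in> \<C>" "p \<in> P" "q \<in> Q" by auto
      then have "P \<subseteq> Q \<or> Q \<subseteq> P" using ch by (auto simp: subset.chain_def)
      then obtain D where "D \<in> \<C>" "p \<in> D" "q \<in> D" using PQ by auto
      moreover from this have "disjoint_family_on b D" using sub by (auto simp: \<A>_def)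
      ultimately show "b p \<inter> b q = {}" using ne by (auto simp: disjoint_family_on_def)
    qed
    moreover have "\<exists>q\<in>\<Union>\<C>. b p \<inter> b q \<noteq> {} \<and> snd p \<le> 2 * snd q"
      if p: "p \<in> B" "\<exists>q\<in>\<Union>\<C>. b p \<inter> b q \<noteq> {}" for p
    proof -
      obtain D where D: "D \<in> \<C>" "\<exists>q\<in>D. b p \<inter> b q \<noteq> {}" using p by auto
      then have "\<exists>q\<in>D. b p \<inter> b q \<noteq> {} \<and> snd p \<le> 2 * snd q"
        using sub p(1) by (auto simp: \<A>_def)
      then show ?thesis using D by blast
    qed
    moreover have "\<Union>\<C> \<subseteq> B" using sub by (auto simp: \<A>_def)
    ultimately show "\<Union>\<C> \<in> \<A>" unfolding \<A>_def by blast
  qed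
  then obtain D where DA: "D \<in> \<A>" and max: "\<And>X. X \<in> \<A> \<Longrightarrow> D \<subseteq> X \<Longrightarrow> X = D" by auto
  then have D: "D \<subseteq> B" "disjoint_family_on b D"
    "\<And>p. p \<in> B \<Longrightarrow> \<exists>q\<in>D. b p \<inter> b q \<noteq> {} \<Longrightarrow> \<exists>q\<in>D. b p \<inter> b q \<noteq> {} \<and> snd p \<le> 2 * snd q"
    by (auto simp: \<A>_def)
  have meets: "\<exists>q\<in>D. b p \<inter> b q \<noteq> {}" if "p \<in> B" for p
  proof (rule ccontr)
    \<comment> \<open>\<open>F\<close> collects the balls that miss all of \<open>D\<close>. Adding
      to \<open>D\<close> a member \<open>p0\<close> of more than half the supremal radius
      \<open>S\<close> keeps the invariant, because a ball of \<open>F\<close> meeting it has radius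
      at most \<open>S\<close>. This contradicts maximality.\<close>
    define F where "F = {p \<in> B. \<forall>q\<in>D. b p \<inter> b q = {}}"
    define S where "S = Sup (snd ` F)"
    assume "\<not> ?thesis"
    then have pF: "p \<in> F" using that by (auto simp: F_def)
    have bdd: "bdd_above (snd ` F)"
      unfolding F_def using B by (intro bdd_aboveI[of _ R]) force
    have le: "snd q \<le> S" if "q \<in> F" for q
      unfolding S_def using bdd that by (intro cSup_upper) auto
    have "0 < snd p" using B[of "fst p" "snd p"] \<open>p \<in> B\<close> by simp
    then have "S / 2 < S" using le[OF pF] by simp
    then obtain p0 where p0: "p0 \<in> F" "S / 2 < snd p0"
      unfolding S_def using pF bdd by (subst (asm) less_cSup_iff) auto
    have "insert p0 D \<in> \<A>"
    proof -
      have "disjoint_family_on b (insert p0 D)"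
        using p0 D(2) unfolding disjoint_family_on_def F_def by blast
      moreover have "\<exists>q\<in>insert p0 D. b p \<inter> b q \<noteq> {} \<and> snd p \<le> 2 * snd q"
        if p: "p \<in> B" "\<exists>q\<in>insert p0 D. b p \<inter> b q \<noteq> {}" for p
      proof (cases "\<exists>q\<in>D. b p \<inter> b q \<noteq> {}")
        case True
        then show ?thesis using D(3)[OF p(1)] by blast
      next
        case False
        then have "p \<in> F" "b p \<inter> b p0 \<noteq> {}" using p by (auto simp: F_def)
        then show ?thesis using le[of p] p0(2) by auto
      qed
      moreover have "insert p0 D \<subseteq> B" using D(1) p0(1) by (auto simp: F_def)
      ultimately show ?thesis unfolding \<A>_def by blast
    qed
    then have "p0 \<in> D" using max by blast
    moreover have "fst p0 \<in> b p0" using p0(1) B[of "fst p0" "snd p0"] by (auto simp: F_def b_def)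
    ultimately show False using p0(1) by (auto simp: F_def)
  qed
  show ?thesis
  proof (rule that[OF D(1)])
    show "disjoint_family_on (\<lambda>p. ball (fst p) (snd p)) D" using D(2) by (simp add: b_def[abs_def])
    fix x r assume xr: "(x, r) \<in> B"
    obtain q where q: "q \<in> D" "b (x, r) \<inter> b q \<noteq> {}" "r \<le> 2 * snd q"
      using D(3)[OF xr meets[OF xr]] by auto
    then obtain z where "dist x z < r" "dist (fst q) z < snd q" by (auto simp: b_def)
    \<comment> \<open>The distance is below \<open>snd q + r + r\<close>, and
      \<open>r \<le> 2 * snd q\<close>; this is where the factor \<open>5\<close> comes
      from.\<close>
    then have "dist (fst q) y < 5 * snd q" if "dist x y < r" for y
      using q(3) that dist_triangle[of "fst q" y z] dist_triangle[of z y x] by (simp add: dist_commute)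
    then have "ball x r \<subseteq> ball (fst q) (5 * snd q)" by auto
    then show "\<exists>p\<in>D. ball x r \<subseteq> ball (fst p) (5 * snd p)" using q(1) by blast
  qed
qed

text \<open>Among the given balls a disjoint subfamily is selected whose fivefold enlargements cover
  \<open>E\<close>. An enlargement costs at most \<open>(10 * r) powr s\<close>, which is
  \<open>10 powr s / t\<close> times the lower bound for the mass of \<open>D\<close> in the
  original ball, and these masses add up to at most that of \<open>D\<close>.\<close>

lemma hausdorff_pre_le_of_dense_balls:
  fixes E D :: "'a::metric_space set"
  assumes s: "0 < s" and t: "0 < t" and \<delta>: "0 < \<delta>" and fin: "hausdorff s D < top"
    and dens: "\<And>z. z \<in> E \<Longrightarrow> \<exists>r. 0 < r \<and> 10 * r \<le> \<delta> \<and> ennreal (t * r powr s) \<le> hausdorff s (D \<inter> ball z r)"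
  shows "hausdorff_pre s \<delta> E \<le> ennreal (10 powr s / t) * hausdorff s D"
proof -
  have "\<forall>z\<in>E. \<exists>r. 0 < r \<and> 10 * r \<le> \<delta> \<and> ennreal (t * r powr s) \<le> hausdorff s (D \<inter> ball z r)"
    using dens by blast
  from bchoice[OF this] obtain r where r: "\<And>z. z \<in> E \<Longrightarrow> 0 < r z" "\<And>z. z \<in> E \<Longrightarrow> 10 * r z \<le> \<delta>"
    "\<And>z. z \<in> E \<Longrightarrow> ennreal (t * r z powr s) \<le> hausdorff s (D \<inter> ball z (r z))" by blast
  have \<rho>: "0 < \<rho> \<and> \<rho> \<le> \<delta> / 10" if "(z, \<rho>) \<in> (\<lambda>z. (z, r z)) ` E" for z \<rho>
    using that r(1,2) by fastforce
  obtain \<Omega> where \<Omega>: "\<Omega> \<subseteq> (\<lambda>z. (z, r z)) ` E"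
    "disjoint_family_on (\<lambda>p. ball (fst p) (snd p)) \<Omega>"
    "\<And>x r'. (x, r') \<in> (\<lambda>z. (z, r z)) ` E \<Longrightarrow> \<exists>p\<in>\<Omega>. ball x r' \<subseteq> ball (fst p) (5 * snd p)"
    by (rule Vitali_5r_covering[OF \<rho>]) (assumption, rule that, assumption+)
  have \<Omega>D: "0 < snd p" "10 * snd p \<le> \<delta>" "ennreal (t * snd p powr s) \<le> hausdorff s (D \<inter> ball (fst p) (snd p))"
    if "p \<in> \<Omega>" for p using that \<Omega>(1) r by auto
  have sumF: "(\<Sum>p\<in>F. ennreal (t * snd p powr s)) \<le> hausdorff s D" if "F \<subseteq> \<Omega>" "finite F" for F
  proof -
    have "(\<Sum>p\<in>F. ennreal (t * snd p powr s)) \<le> (\<Sum>p\<in>F. hausdorff s (D \<inter> ball (fst p) (snd p)))"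
      using that by (intro sum_mono \<Omega>D) auto
    also have "\<dots> \<le> hausdorff s D"
      using s that \<Omega>(2) by (intro sum_hausdorff_Int_le) (auto intro: disjoint_family_on_mono)
    finally show ?thesis .
  qed
  \<comment> \<open>Summability of strictly positive weights forces the index set to be
    countable.\<close>
  have "(\<lambda>p. t * snd p powr s) summable_on \<Omega>"
  proof (rule nonneg_bdd_above_summable_on)
    show "bdd_above (sum (\<lambda>p. t * snd p powr s) ` {F. F \<subseteq> \<Omega> \<and> finite F})"
    proof (rule bdd_aboveI2)
      fix F assume F: "F \<in> {F. F \<subseteq> \<Omega> \<and> finite F}"
      then have "ennreal (\<Sum>p\<in>F. t * snd p powr s) \<le> hausdorff s D"
        using sumF[of F] t by (simp add: sum_ennreal)
      also have "\<dots> = ennreal (enn2real (hausdorff s D))" using fin by simp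
      finally show "(\<Sum>p\<in>F. t * snd p powr s) \<le> enn2real (hausdorff s D)"
        by (simp add: ennreal_le_iff)
    qed
  qed (use t in auto)
  from summable_countable_real[OF this] have "countable {p \<in> \<Omega>. t * snd p powr s \<noteq> 0}" .
  moreover have "{p \<in> \<Omega>. t * snd p powr s \<noteq> 0} = \<Omega>" using \<Omega>D(1) t by fastforce
  ultimately have cnt: "countable \<Omega>" by simp
  define e where "e = to_nat_on \<Omega>"
  have inj: "inj_on e \<Omega>" unfolding e_def using cnt by (rule inj_on_to_nat_on)
  \<comment> \<open>The selected family may be finite; indices outside the enumeration contribute
    the empty set, at cost \<open>0\<close>.\<close>
  define C where "C n = (if n \<in> e ` \<Omega> then ball (fst (inv_into \<Omega> e n)) (5 * snd (inv_into \<Omega> e n)) else {})" for n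
  have dball: "bounded (ball x (5 * \<rho>))" "diameter (ball x (5 * \<rho>)) \<le> 10 * \<rho>" if "0 < \<rho>" for x :: 'a and \<rho>
  proof -
    have "dist y z \<le> 10 * \<rho>" if "y \<in> ball x (5 * \<rho>)" "z \<in> ball x (5 * \<rho>)" for y z
      using that dist_triangle[of y z x] by (simp add: dist_commute)
    then show "diameter (ball x (5 * \<rho>)) \<le> 10 * \<rho>" using \<open>0 < \<rho>\<close> by (intro diameter_leI) auto
  qed auto
  have bC: "bounded (C n)" for n by (simp add: C_def)
  have inv\<Omega>: "inv_into \<Omega> e n \<in> \<Omega>" if "n \<in> e ` \<Omega>" for n using that by (rule inv_into_into)
  have dC: "diameter (C n) \<le> 10 * snd (inv_into \<Omega> e n)" if "n \<in> e ` \<Omega>" for n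
    using dball(2) \<Omega>D(1)[OF inv\<Omega>[OF that]] that by (simp add: C_def)
  have "hausdorff_pre s \<delta> E \<le> (\<Sum>n. ennreal (diameter (C n) powr s))"
  proof (rule hausdorff_pre_le[OF _ bC])
    show "diameter (C n) \<le> \<delta>" for n
    proof (cases "n \<in> e ` \<Omega>")
      case True
      then show ?thesis using dC[OF True] \<Omega>D(2)[OF inv\<Omega>[OF True]] by simp
    qed (use \<delta> in \<open>simp add: C_def\<close>)
    show "E \<subseteq> (\<Union>n. C n)"
    proof
      fix z assume z: "z \<in> E"
      then obtain p where p: "p \<in> \<Omega>" "ball z (r z) \<subseteq> ball (fst p) (5 * snd p)" using \<Omega>(3) by blast
      have "z \<in> ball z (r z)" using r(1)[OF z] by simp
      with p(2) have "z \<in> ball (fst p) (5 * snd p)" by (rule subsetD)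
      then have "z \<in> C (e p)" using p(1) inj by (simp add: C_def)
      then show "z \<in> (\<Union>n. C n)" by blast
    qed
  qed
  also have "\<dots> \<le> ennreal (10 powr s / t) * hausdorff s D"
  proof (rule suminf_le_const)
    fix N
    define F where "F = inv_into \<Omega> e ` ({..<N} \<inter> e ` \<Omega>)"
    have F: "F \<subseteq> \<Omega>" "finite F" using inv\<Omega> by (auto simp: F_def)
    have "(\<Sum>n<N. ennreal (diameter (C n) powr s)) = (\<Sum>n\<in>{..<N} \<inter> e ` \<Omega>. ennreal (diameter (C n) powr s))"
      using s by (intro sum.mono_neutral_right) (auto simp: C_def)
    also have "\<dots> \<le> (\<Sum>n\<in>{..<N} \<inter> e ` \<Omega>. ennreal ((10 * snd (inv_into \<Omega> e n)) powr s))"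
      using dC s by (intro sum_mono ennreal_leI powr_mono2 diameter_ge_0 bC) auto
    also have "\<dots> = (\<Sum>p\<in>F. ennreal ((10 * snd p) powr s))"
      unfolding F_def by (subst sum.reindex) (auto intro!: inj_on_inv_into simp: inj_on_inv_into)
    also have "\<dots> = (\<Sum>p\<in>F. ennreal (10 powr s / t) * ennreal (t * snd p powr s))"
      using t by (intro sum.cong refl) (simp add: ennreal_mult[symmetric] powr_mult)
    also have "\<dots> = ennreal (10 powr s / t) * (\<Sum>p\<in>F. ennreal (t * snd p powr s))"
      by (simp add: sum_distrib_left)
    also have "\<dots> \<le> ennreal (10 powr s / t) * hausdorff s D"
      by (intro mult_left_mono sumF F) auto
    finally show "(\<Sum>n<N. ennreal (diameter (C n) powr s)) \<le> ennreal (10 powr s / t) * hausdorff s D" .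
  qed auto
  finally show ?thesis .
qed

section \<open>Points of density zero\<close>

text \<open>Vanishing \<open>s\<close>-density, stated without quotients in \<open>ennreal\<close>;
  the usual factor \<open>2 powr s\<close> is absorbed into \<open>t\<close>.\<close>

definition zero_density :: "real \<Rightarrow> 'a::metric_space set \<Rightarrow> 'a \<Rightarrow> bool" where
  "zero_density s A z \<longleftrightarrow>
    (\<forall>t>0. \<exists>R>0. \<forall>r. 0 < r \<and> r < R \<longrightarrow> hausdorff s (A \<inter> ball z r) \<le> ennreal (t * r powr s))"

lemma zero_densityE:
  assumes "zero_density s A z" "0 < t"
  obtains R where "0 < R" "\<And>r. 0 < r \<Longrightarrow> r < R \<Longrightarrow> hausdorff s (A \<inter> ball z r) \<le> ennreal (t * r powr s)"
proof -
  from assms(1)[unfolded zero_density_def, rule_format, OF assms(2)]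
  obtain R where R: "R > 0" "\<forall>r. 0 < r \<and> r < R \<longrightarrow> hausdorff s (A \<inter> ball z r) \<le> ennreal (t * r powr s)"
    by blast
  show ?thesis by (rule that[OF R(1)]) (use R(2) in simp)
qed

text \<open>Continuity from above needs Borel sets, whereas \<open>A\<close> is arbitrary. It is
  applied to the union of all \<open>C n\<close> minus \<open>C n\<close>, which differs from
  \<open>A - C n\<close> by a null set.\<close>

lemma hausdorff_Diff_incseq_tendsto_zero:
  fixes C :: "nat \<Rightarrow> 'a::metric_space set"
  assumes s: "0 \<le> s" and fin: "hausdorff s A < top" and C: "\<And>n. C n \<in> sets borel" "\<And>n. C n \<subseteq> A" "incseq C"
    and null: "hausdorff s (A - (\<Union>n. C n)) = 0"
  shows "(\<lambda>n. hausdorff s (A - C n)) \<longlonglongrightarrow> 0"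
proof -
  let ?V = "\<lambda>n. (\<Union>k. C k) - C n"
  have V: "?V n \<in> sets borel" for n using C(1) by auto
  have le: "hausdorff s B < top" if "B \<subseteq> A" for B using hausdorff_mono[OF that] fin le_less_trans by blast
  have "(\<lambda>n. emeasure (hausdorff_measure s) (?V n)) \<longlonglongrightarrow> emeasure (hausdorff_measure s) (\<Inter>n. ?V n)"
  proof (rule Lim_emeasure_decseq)
    show "decseq ?V" using C(3) by (fastforce simp: decseq_def incseq_def)
    show "emeasure (hausdorff_measure s) (?V n) \<noteq> \<infinity>" for n
      using le[of "?V n"] C(2) emeasure_hausdorff_measure[OF s V, of n] by (auto simp: less_top[symmetric])
  qed (use V in auto)
  moreover have "(\<Inter>n. ?V n) = {}" by auto
  ultimately have lim: "(\<lambda>n. hausdorff s (?V n)) \<longlonglongrightarrow> 0"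
    by (simp only: emeasure_hausdorff_measure[OF s V] emeasure_empty)
  have "hausdorff s (A - C n) \<le> hausdorff s (?V n)" for n
  proof -
    have "hausdorff s (A - C n) \<le> hausdorff s ((A - (\<Union>n. C n)) \<union> ?V n)" by (rule hausdorff_mono) auto
    also have "\<dots> \<le> hausdorff s (A - (\<Union>n. C n)) + hausdorff s (?V n)" by (rule hausdorff_Un_le)
    finally show ?thesis using null by simp
  qed
  then show ?thesis
    by (intro tendsto_sandwich[OF _ _ tendsto_const lim]) auto
qed

text \<open>A small ball around a point outside \<open>A\<close> misses the closed set
  \<open>C n\<close>, so it sees only the mass of \<open>A - C n\<close>. The covering estimate then
  bounds the bad points by a multiple of that mass, which tends to \<open>0\<close>.\<close>

lemma hausdorff_AE_zero_density:
  fixes C :: "nat \<Rightarrow> 'a::metric_space set"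
  assumes s: "0 < s" and fin: "hausdorff s A < top" and C: "\<And>n. closed (C n)" "\<And>n. C n \<subseteq> A" "incseq C"
    and null: "hausdorff s (A - (\<Union>n. C n)) = 0"
  shows "hausdorff s {z. z \<notin> A \<and> \<not> zero_density s A z} = 0"
proof -
  \<comment> \<open>The thresholds \<open>1 / real (Suc k)\<close> reduce the failure of zero
    density to countably many exceptional sets.\<close>
  define F where "F k = {z. z \<notin> A \<and> (\<forall>R>0. \<exists>r. 0 < r \<and> r < R \<and>
      ennreal (1 / real (Suc k) * r powr s) < hausdorff s (A \<inter> ball z r))}" for k
  have "{z. z \<notin> A \<and> \<not> zero_density s A z} \<subseteq> (\<Union>k. F k)"
  proof clarify
    fix z assume z: "z \<notin> A" "\<not> zero_density s A z"
    then obtain t where t: "t > 0"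
      "\<And>R. R > 0 \<Longrightarrow> \<exists>r. 0 < r \<and> r < R \<and> ennreal (t * r powr s) < hausdorff s (A \<inter> ball z r)"
      unfolding zero_density_def by (metis not_le)
    obtain k where k: "1 / real (Suc k) < t" using t(1) by (rule nat_approx_posE)
    have "z \<in> F k" unfolding F_def
    proof (clarsimp simp only: mem_Collect_eq z(1) not_False_eq_True simp_thms)
      fix R :: real assume "0 < R"
      from t(2)[OF this] obtain r where r: "0 < r" "r < R" "ennreal (t * r powr s) < hausdorff s (A \<inter> ball z r)"
        by blast
      have "ennreal (1 / real (Suc k) * r powr s) \<le> ennreal (t * r powr s)"
        using k by (intro ennreal_leI mult_right_mono) auto
      then show "\<exists>r. 0 < r \<and> r < R \<and> ennreal (1 / real (Suc k) * r powr s) < hausdorff s (A \<inter> ball z r)"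
        using r le_less_trans by blast
    qed
    then show "z \<in> (\<Union>k. F k)" by blast
  qed
  moreover have "hausdorff s (F k) = 0" for k
  proof -
    let ?c = "ennreal (10 powr s / (1 / real (Suc k)))"
    have "hausdorff_pre s \<delta> (F k) \<le> 0" if \<delta>: "0 < \<delta>" for \<delta>
    proof -
      have le: "hausdorff_pre s \<delta> (F k) \<le> ?c * hausdorff s (A - C n)" for n
      proof (rule hausdorff_pre_le_of_dense_balls[OF s _ \<delta>])
        show "hausdorff s (A - C n) < top"
          using hausdorff_mono[of "A - C n" A s] fin by (auto intro: le_less_trans)
        fix z assume z: "z \<in> F k"
        then have "z \<in> - C n" using C(2) by (auto simp: F_def)
        then obtain \<rho> where \<rho>: "\<rho> > 0" "ball z \<rho> \<subseteq> - C n"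
          using C(1)[of n] by (metis open_Compl open_contains_ball)
        have "0 < min \<rho> (\<delta> / 10)" using \<rho> \<delta> by simp
        then obtain r where r: "0 < r" "r < min \<rho> (\<delta> / 10)"
          "ennreal (1 / real (Suc k) * r powr s) < hausdorff s (A \<inter> ball z r)"
          using z unfolding F_def by blast
        have "ball z r \<subseteq> ball z \<rho>" using r(2) by (intro subset_ball) simp
        then have "A \<inter> ball z r = (A - C n) \<inter> ball z r" using \<rho>(2) by auto
        then show "\<exists>r. 0 < r \<and> 10 * r \<le> \<delta> \<and>
            ennreal (1 / real (Suc k) * r powr s) \<le> hausdorff s ((A - C n) \<inter> ball z r)"
          using r by (intro exI[of _ r]) auto
      qed auto
      have lim: "(\<lambda>n. ?c * hausdorff s (A - C n)) \<longlonglongrightarrow> ?c * 0"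
        using s C by (intro tendsto_mult_ennreal tendsto_const hausdorff_Diff_incseq_tendsto_zero fin null) auto
      have "hausdorff_pre s \<delta> (F k) \<le> ?c * 0"
        by (rule LIMSEQ_le_const[OF lim]) (use le in blast)
      then show ?thesis by simp
    qed
    then have "hausdorff s (F k) \<le> 0" by (rule hausdorff_leI)
    then show ?thesis by simp
  qed
  then have "hausdorff s (\<Union>k. F k) = 0" by (intro hausdorff_null_UN) auto
  ultimately show ?thesis by (metis hausdorff_null_subset)
qed

section \<open>Spaces of finite Hausdorff measure\<close>

text \<open>An empty family of covers would have infimum \<open>top\<close>, so finite measure
  provides a cover at each scale. Closures keep the diameters.\<close>

lemma hausdorff_finite_closed_cover:
  assumes "hausdorff s (UNIV :: 'a::metric_space set) < top" "0 < \<delta>"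
  obtains C :: "nat \<Rightarrow> 'a::metric_space set"
  where "(\<Union>i. C i) = UNIV" "\<And>i. closed (C i)" "\<And>i x y. x \<in> C i \<Longrightarrow> y \<in> C i \<Longrightarrow> dist x y \<le> \<delta>"
proof -
  have "hausdorff_pre s \<delta> (UNIV :: 'a set) < top"
    using hausdorff_pre_le_hausdorff[OF assms(2)] assms(1) by (rule le_less_trans)
  then obtain B :: "nat \<Rightarrow> 'a set" where B: "UNIV \<subseteq> (\<Union>i. B i)" "\<And>i. bounded (B i)" "\<And>i. diameter (B i) \<le> \<delta>"
    by (rule hausdorff_pre_near_cover) (rule that, assumption+)
  show ?thesis
  proof (rule that[of "\<lambda>i. closure (B i)"])
    show "(\<Union>i. closure (B i)) = UNIV" using B(1) closure_subset by blast
    fix i x y assume "x \<in> closure (B i)" "y \<in> closure (B i)"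
    then have "dist x y \<le> diameter (closure (B i))"
      using B(2) by (intro diameter_bounded_bound) auto
    then show "dist x y \<le> \<delta>" using B(3)[of i] diameter_closure[OF B(2)[of i]] by simp
  qed auto
qed

lemma hausdorff_finite_separable:
  assumes "hausdorff s (UNIV :: 'a::metric_space set) < top"
  obtains Q :: "'a::metric_space set" where "countable Q" "\<And>x e. 0 < e \<Longrightarrow> \<exists>q\<in>Q. dist q x < e"
proof -
  have "\<forall>n. \<exists>C :: nat \<Rightarrow> 'a set. (\<Union>i. C i) = UNIV \<and> (\<forall>i. \<forall>x\<in>C i. \<forall>y\<in>C i. dist x y \<le> 1 / real (Suc n))"
  proof
    fix n
    have "0 < 1 / real (Suc n)" by simp
    then obtain C :: "nat \<Rightarrow> 'a set" where "(\<Union>i. C i) = UNIV"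
      "\<And>i x y. x \<in> C i \<Longrightarrow> y \<in> C i \<Longrightarrow> dist x y \<le> 1 / real (Suc n)"
      by (rule hausdorff_finite_closed_cover[OF assms]) (rule that, assumption+)
    then show "\<exists>C :: nat \<Rightarrow> 'a set. (\<Union>i. C i) = UNIV \<and> (\<forall>i. \<forall>x\<in>C i. \<forall>y\<in>C i. dist x y \<le> 1 / real (Suc n))"
      by (intro exI[of _ C]) simp
  qed
  from choice[OF this] obtain C :: "nat \<Rightarrow> nat \<Rightarrow> 'a set" where
    C: "\<forall>n. (\<Union>i. C n i) = UNIV \<and> (\<forall>i. \<forall>x\<in>C n i. \<forall>y\<in>C n i. dist x y \<le> 1 / real (Suc n))" ..
  \<comment> \<open>For an empty piece \<open>SOME\<close> gives an arbitrary point, which does no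
    harm.\<close>
  define Q where "Q = (\<Union>n. \<Union>i. {SOME x. x \<in> C n i})"
  show ?thesis
  proof (rule that)
    show "countable Q" unfolding Q_def by (intro countable_UN) auto
    fix x :: 'a and e :: real assume "0 < e"
    then obtain n where n: "1 / real (Suc n) < e" by (rule nat_approx_posE)
    have "x \<in> (\<Union>i. C n i)" using C by simp
    then obtain i where i: "x \<in> C n i" by blast
    define q where "q = (SOME x. x \<in> C n i)"
    have "q \<in> C n i" using i unfolding q_def by (rule someI)
    then have "dist q x \<le> 1 / real (Suc n)" using C i by simp
    moreover have "q \<in> Q" by (auto simp: Q_def q_def)
    ultimately show "\<exists>q\<in>Q. dist q x < e" using n by (intro bexI[of _ q]) auto
  qed
qed

text \<open>At each mesh finitely many closed pieces carry all but
  \<open>\<epsilon> * (1/2) ^ Suc n\<close> of the measure. The intersection of these finite unions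
  is closed and totally bounded, hence compact by completeness.\<close>

lemma hausdorff_tight_eps:
  assumes s: "0 \<le> s" and fin: "hausdorff s (UNIV :: 'a::complete_space set) < top" and "0 < \<epsilon>"
  obtains K :: "'a::complete_space set" where "compact K" "hausdorff s (- K) \<le> ennreal \<epsilon>"
proof -
  have "\<forall>n. \<exists>F :: 'a set. closed F \<and> hausdorff s (- F) \<le> ennreal (\<epsilon> * (1/2) ^ Suc n) \<and>
     (\<exists>k. finite k \<and> F \<subseteq> (\<Union>x\<in>k. cball x (1 / real (Suc n))))"
  proof
    fix n
    have "0 < 1 / real (Suc n)" by simp
    then obtain C :: "nat \<Rightarrow> 'a set" where C: "(\<Union>i. C i) = UNIV" "\<And>i. closed (C i)"
      "\<And>i x y. x \<in> C i \<Longrightarrow> y \<in> C i \<Longrightarrow> dist x y \<le> 1 / real (Suc n)"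
      by (rule hausdorff_finite_closed_cover[OF fin]) (rule that, assumption+)
    let ?F = "\<lambda>k. \<Union>i<k. C i"
    have clF: "closed (?F k)" for k using C(2) by auto
    have "(\<Union>k. ?F k) = (UNIV :: 'a set)"
    proof -
      have "C i \<subseteq> ?F (Suc i)" for i by auto
      then have "(\<Union>i. C i) \<subseteq> (\<Union>k. ?F k)" by (intro UN_least) blast
      then show ?thesis unfolding C(1) by (rule top_le)
    qed
    moreover have "incseq ?F" unfolding incseq_def by (intro allI impI UN_mono) auto
    ultimately have "(\<lambda>k. hausdorff s (- ?F k)) \<longlonglongrightarrow> 0"
      unfolding Compl_eq_Diff_UNIV using s fin clF by (intro hausdorff_Diff_incseq_tendsto_zero) auto
    moreover have "0 < ennreal (\<epsilon> * (1/2) ^ Suc n)" using \<open>0 < \<epsilon>\<close> by simp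
    ultimately have "\<forall>\<^sub>F k in sequentially. hausdorff s (- ?F k) < ennreal (\<epsilon> * (1/2) ^ Suc n)"
      by (rule order_tendstoD(2))
    then obtain k where "hausdorff s (- ?F k) < ennreal (\<epsilon> * (1/2) ^ Suc n)"
      by (meson eventually_happens sequentially_bot)
    moreover have "?F k \<subseteq> (\<Union>x\<in>(\<lambda>i. SOME x. x \<in> C i) ` {..<k}. cball x (1 / real (Suc n)))"
    proof
      fix x assume "x \<in> ?F k"
      then obtain i where i: "i < k" "x \<in> C i" by blast
      then have "(SOME x. x \<in> C i) \<in> C i" by (auto intro: someI)
      then have "x \<in> cball (SOME x. x \<in> C i) (1 / real (Suc n))" using C(3) i by simp
      then show "x \<in> (\<Union>x\<in>(\<lambda>i. SOME x. x \<in> C i) ` {..<k}. cball x (1 / real (Suc n)))"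
        using i(1) by blast
    qed
    ultimately show "\<exists>F :: 'a set. closed F \<and> hausdorff s (- F) \<le> ennreal (\<epsilon> * (1/2) ^ Suc n) \<and>
     (\<exists>k. finite k \<and> F \<subseteq> (\<Union>x\<in>k. cball x (1 / real (Suc n))))"
      using clF by (intro exI[of _ "?F k"] conjI exI[of _ "(\<lambda>i. SOME x. x \<in> C i) ` {..<k}"]
        less_imp_le[of "hausdorff s (- ?F k)"] finite_imageI finite_lessThan)
  qed
  from choice[OF this] obtain F :: "nat \<Rightarrow> 'a set" where
    F: "\<forall>n. closed (F n) \<and> hausdorff s (- F n) \<le> ennreal (\<epsilon> * (1/2) ^ Suc n) \<and>
     (\<exists>k. finite k \<and> F n \<subseteq> (\<Union>x\<in>k. cball x (1 / real (Suc n))))" ..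
  define K where "K = (\<Inter>n. F n)"
  have "compact K"
    unfolding compact_eq_totally_bounded
  proof (intro conjI allI impI)
    show "complete K" unfolding complete_eq_closed K_def using F by blast
    fix e :: real assume "0 < e"
    then obtain n where n: "1 / real (Suc n) < e" by (rule nat_approx_posE)
    obtain k where k: "finite k" "F n \<subseteq> (\<Union>x\<in>k. cball x (1 / real (Suc n)))" using F by blast
    have "(\<Union>x\<in>k. cball x (1 / real (Suc n))) \<subseteq> (\<Union>x\<in>k. ball x e)"
      using n by (intro UN_mono order_refl) auto
    moreover have "K \<subseteq> F n" by (auto simp: K_def)
    ultimately have "K \<subseteq> (\<Union>x\<in>k. ball x e)" using k(2) by (meson order_trans)
    then show "\<exists>k. finite k \<and> K \<subseteq> (\<Union>x\<in>k. ball x e)" using k(1) by (intro exI[of _ k] conjI)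
  qed
  moreover have "hausdorff s (- K) \<le> ennreal \<epsilon>"
  proof -
    have "hausdorff s (- K) \<le> (\<Sum>n. hausdorff s (- F n))"
      unfolding K_def Compl_INT by (rule hausdorff_UN_le)
    also have "\<dots> \<le> (\<Sum>n. ennreal (\<epsilon> * (1/2) ^ Suc n))"
      by (intro suminf_le F[rule_format, THEN conjunct2, THEN conjunct1]) auto
    also have "\<dots> = ennreal \<epsilon>"
      using sums_mult[OF power_half_series, of \<epsilon>] \<open>0 < \<epsilon>\<close> by (intro suminf_ennreal_eq) auto
    finally show ?thesis .
  qed
  ultimately show ?thesis by (rule that)
qed

lemma hausdorff_tight:
  assumes s: "0 \<le> s" and fin: "hausdorff s (UNIV :: 'a::complete_space set) < top"
  obtains K :: "nat \<Rightarrow> 'a::complete_space set" where "\<And>n. compact (K n)" "incseq K" "hausdorff s (- (\<Union>n. K n)) = 0"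
proof -
  have "\<forall>n. \<exists>K :: 'a set. compact K \<and> hausdorff s (- K) \<le> ennreal (1 / real (Suc n))"
  proof
    fix n
    have "0 < 1 / real (Suc n)" by simp
    from hausdorff_tight_eps[OF assms this] obtain K :: "'a set"
      where "compact K" "hausdorff s (- K) \<le> ennreal (1 / real (Suc n))" .
    then show "\<exists>K :: 'a set. compact K \<and> hausdorff s (- K) \<le> ennreal (1 / real (Suc n))" by blast
  qed
  from choice[OF this] obtain K :: "nat \<Rightarrow> 'a set" where
    K: "\<forall>n. compact (K n) \<and> hausdorff s (- K n) \<le> ennreal (1 / real (Suc n))" ..
  define J where "J n = (\<Union>i\<le>n. K i)" for n
  have "hausdorff s (- (\<Union>n. J n)) \<le> 0"
  proof (rule ennreal_le_epsilon)
    fix e :: real assume "0 < e"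
    then obtain n where n: "1 / real (Suc n) < e" by (rule nat_approx_posE)
    have "K n \<subseteq> (\<Union>n. J n)" by (auto simp: J_def)
    then have "hausdorff s (- (\<Union>n. J n)) \<le> hausdorff s (- K n)" by (intro hausdorff_mono) blast
    also have "\<dots> \<le> ennreal (1 / real (Suc n))" using K by blast
    also have "\<dots> \<le> ennreal e" using n by (intro ennreal_leI) simp
    finally show "hausdorff s (- (\<Union>n. J n)) \<le> 0 + ennreal e" by simp
  qed
  moreover have "compact (J n)" for n unfolding J_def using K by (intro compact_UN) auto
  moreover have "incseq J" unfolding incseq_def J_def by (intro allI impI UN_mono) auto
  ultimately show ?thesis by (intro that[of J]) auto
qed

text \<open>The superlevel sets of the distance to the complement exhaust \<open>U\<close>. The
  whole space is treated apart because \<open>infdist\<close> to the empty set is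
  \<open>0\<close>.\<close>

lemma open_eq_UN_closed:
  fixes U :: "'a::metric_space set"
  assumes "open U"
  obtains F :: "nat \<Rightarrow> 'a set" where "\<And>n. closed (F n)" "incseq F" "(\<Union>n. F n) = U"
proof (cases "- U = {}")
  case True
  then have "U = UNIV" by auto
  then show ?thesis by (intro that[of "\<lambda>_. UNIV"]) (simp_all add: incseq_def)
next
  case False
  define F where "F n = {x. 1 / real (Suc n) \<le> infdist x (- U)}" for n
  show ?thesis
  proof (rule that)
    show "closed (F n)" for n unfolding F_def by (intro closed_Collect_le continuous_intros)
    show "incseq F"
    proof (rule incseq_SucI)
      fix n
      have "1 / real (Suc (Suc n)) \<le> 1 / real (Suc n)" by (intro frac_le) auto
      then show "F n \<subseteq> F (Suc n)" by (auto simp: F_def)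
    qed
    have pos: "x \<in> U \<longleftrightarrow> 0 < infdist x (- U)" for x
    proof -
      have "x \<in> U \<longleftrightarrow> infdist x (- U) \<noteq> 0"
        using in_closed_iff_infdist_zero[of "- U" x] assms False by (metis Compl_iff closed_Compl)
      then show ?thesis using infdist_nonneg[of x "- U"] by linarith
    qed
    have ex: "0 < infdist x (- U) \<longleftrightarrow> (\<exists>n. 1 / real (Suc n) \<le> infdist x (- U))" for x
    proof
      assume "0 < infdist x (- U)"
      then obtain n where "1 / real (Suc n) < infdist x (- U)" by (rule nat_approx_posE)
      then show "\<exists>n. 1 / real (Suc n) \<le> infdist x (- U)" by (intro exI[of _ n] less_imp_le)
    next
      assume "\<exists>n. 1 / real (Suc n) \<le> infdist x (- U)"
      then obtain n where "1 / real (Suc n) \<le> infdist x (- U)" ..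
      moreover have "0 < 1 / real (Suc n)" by simp
      ultimately show "0 < infdist x (- U)" by linarith
    qed
    show "(\<Union>n. F n) = U"
    proof (rule set_eqI)
      show "x \<in> (\<Union>n. F n) \<longleftrightarrow> x \<in> U" for x using pos[of x] ex[of x] unfolding F_def by blast
    qed
  qed
qed

text \<open>Continuous images of Borel sets need not be Borel, but this set is a countable union of
  compact sets, whose images are compact.\<close>

lemma borel_image_sigma_compact:
  fixes f :: "'a::metric_space \<Rightarrow> 'b::metric_space"
  assumes "continuous_on UNIV f" "\<And>n::nat. compact (K n)" "closed C" "open U"
  shows "f ` ((\<Union>n. K n) \<inter> (C \<inter> U)) \<in> sets borel"
proof -
  obtain F :: "nat \<Rightarrow> 'a set" where F: "\<And>n. closed (F n)" "(\<Union>n. F n) = U"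
    using open_eq_UN_closed[OF assms(4)] by metis
  have "f ` ((\<Union>n. K n) \<inter> (C \<inter> U)) = (\<Union>n. \<Union>m. f ` (K n \<inter> (C \<inter> F m)))"
    unfolding F(2)[symmetric] by blast
  moreover have "compact (f ` (K n \<inter> (C \<inter> F m)))" for n m
    using assms F(1) by (intro compact_continuous_image compact_Int_closed closed_Int)
      (auto intro: continuous_on_subset)
  ultimately show ?thesis
    by (simp only:) (intro sets.countable_UN image_subsetI borel_closed compact_imp_closed)
qed

section \<open>Multiplicity of Lipschitz maps\<close>

lemma finite_set_dist_lower_bound:
  fixes T :: "'a::metric_space set"
  assumes "finite T"
  obtains n :: nat where "\<And>x y. x \<in> T \<Longrightarrow> y \<in> T \<Longrightarrow> x \<noteq> y \<Longrightarrow> 1 / real (Suc n) < dist x y"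
proof -
  \<comment> \<open>The extra element \<open>1\<close> keeps the set nonempty when \<open>T\<close>
    has at most one point.\<close>
  define D where "D = insert 1 ((\<lambda>p. dist (fst p) (snd p)) ` {p \<in> T \<times> T. fst p \<noteq> snd p})"
  have D: "finite D" "D \<noteq> {}" using assms by (auto simp: D_def)
  then have "0 < Min D" by (subst Min_gr_iff) (auto simp: D_def)
  then obtain n where n: "1 / real (Suc n) < Min D" by (rule nat_approx_posE)
  show ?thesis
  proof (rule that)
    fix x y assume "x \<in> T" "y \<in> T" "x \<noteq> y"
    then have "dist x y \<in> D" by (force simp: D_def)
    then show "1 / real (Suc n) < dist x y" using n Min_le[OF D(1)] by (meson less_le_trans)
  qed
qed

text \<open>The set called \<open>M \<rho>\<close> in the outline. It receives the overlap of the
  images of two disjoint nearby balls.\<close>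

definition close_fibre :: "('a::metric_space \<Rightarrow> 'b) \<Rightarrow> real \<Rightarrow> 'b set" where
  "close_fibre f \<rho> = {z. \<exists>x y. x \<noteq> y \<and> dist x y \<le> \<rho> \<and> f x = z \<and> f y = z}"

text \<open>The number of pieces of a partition of mesh \<open>1 / Suc n\<close> whose image contains a point bounds from
  below, in the limit, the cardinality of its fibre. By Fatou's lemma the limit is integrable, so
  almost every fibre is finite, and the points of a finite fibre are separated.\<close>

lemma hausdorff_Inter_close_fibre:
  fixes f :: "'a::complete_space \<Rightarrow> 'b::metric_space"
  assumes s: "0 \<le> s" and L: "0 < L" and lip: "L-lipschitz_on UNIV f"
    and fin: "hausdorff s (UNIV :: 'a set) < top"
  shows "hausdorff s (\<Inter>n. close_fibre f (1 / real (Suc n))) = 0"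
proof -
  obtain K :: "nat \<Rightarrow> 'a set" where K: "\<And>n. compact (K n)" "incseq K" "hausdorff s (- (\<Union>n. K n)) = 0"
    using hausdorff_tight[OF s fin] by blast
  let ?K = "\<Union>n. K n"
  have cont: "continuous_on UNIV f" using lip by (rule lipschitz_on_continuous_on)
  have lipA: "hausdorff s (f ` A) \<le> ennreal (L powr s) * hausdorff s A" for A
    using s L lipschitz_on_subset[OF lip] by (intro hausdorff_lipschitz_image_le) auto
  have "\<forall>n. \<exists>C :: nat \<Rightarrow> 'a set. (\<Union>i. C i) = UNIV \<and> (\<forall>i. closed (C i)) \<and>
    (\<forall>i. \<forall>x\<in>C i. \<forall>y\<in>C i. dist x y \<le> 1 / real (Suc n))"
  proof
    fix n
    have "0 < 1 / real (Suc n)" by simp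
    then obtain C :: "nat \<Rightarrow> 'a set" where "(\<Union>i. C i) = UNIV" "\<And>i. closed (C i)"
      "\<And>i x y. x \<in> C i \<Longrightarrow> y \<in> C i \<Longrightarrow> dist x y \<le> 1 / real (Suc n)"
      by (rule hausdorff_finite_closed_cover[OF fin]) (rule that, assumption+)
    then show "\<exists>C :: nat \<Rightarrow> 'a set. (\<Union>i. C i) = UNIV \<and> (\<forall>i. closed (C i)) \<and>
      (\<forall>i. \<forall>x\<in>C i. \<forall>y\<in>C i. dist x y \<le> 1 / real (Suc n))"
      by (intro exI[of _ C]) simp
  qed
  from choice[OF this] obtain C :: "nat \<Rightarrow> nat \<Rightarrow> 'a set" where
    C: "\<forall>n. (\<Union>i. C n i) = UNIV \<and> (\<forall>i. closed (C n i)) \<and>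
    (\<forall>i. \<forall>x\<in>C n i. \<forall>y\<in>C n i. dist x y \<le> 1 / real (Suc n))" ..
  define Q where "Q n = disjointed (C n)" for n
  have Q: "(\<Union>i. Q n i) = UNIV" "disjoint_family (Q n)" "Q n i \<in> sets borel" for n i
  proof -
    show "(\<Union>i. Q n i) = UNIV" using C by (simp add: Q_def UN_disjointed_eq)
    show "disjoint_family (Q n)" unfolding Q_def by (rule disjoint_family_disjointed)
    show "Q n i \<in> sets borel" unfolding Q_def disjointed_def using C by (intro sets.Diff sets.finite_UN) auto
  qed
  have dQ: "dist x y \<le> 1 / real (Suc n)" if "x \<in> Q n i" "y \<in> Q n i" for n i x y
  proof -
    have "x \<in> C n i" "y \<in> C n i" using that disjointed_subset[of "C n" i] unfolding Q_def by auto
    then show ?thesis using C by simp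
  qed
  \<comment> \<open>Restricting to the countable union \<open>?K\<close> of compact sets makes these
    images Borel; what is lost has a null image.\<close>
  define S where "S n i = f ` (?K \<inter> Q n i)" for n i
  have S [measurable]: "S n i \<in> sets borel" for n i
  proof -
    have "Q n i = C n i \<inter> - (\<Union>j\<in>{0..<i}. C n j)" by (auto simp: Q_def disjointed_def)
    moreover have "open (- (\<Union>j\<in>{0..<i}. C n j))" using C by (intro open_Compl closed_UN) auto
    ultimately show ?thesis
      unfolding S_def using C by (simp add: borel_image_sigma_compact[OF cont K(1)])
  qed
  let ?H = "hausdorff_measure s :: 'b measure"
  define N where "N n z = (\<Sum>i. indicator (S n i) z :: ennreal)" for n z
  have N [measurable]: "N n \<in> borel_measurable ?H" for n unfolding N_def by measurable
  have intN: "(\<integral>\<^sup>+ z. N n z \<partial>?H) \<le> ennreal (L powr s) * hausdorff s (UNIV :: 'a set)" for n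
  proof -
    have "(\<integral>\<^sup>+ z. N n z \<partial>?H) = (\<Sum>i. \<integral>\<^sup>+ z. indicator (S n i) z \<partial>?H)"
      unfolding N_def by (intro nn_integral_suminf) measurable
    also have "\<dots> = (\<Sum>i. hausdorff s (S n i))"
      using S by (simp add: emeasure_hausdorff_measure[OF s])
    also have "\<dots> \<le> (\<Sum>i. ennreal (L powr s) * hausdorff s (Q n i))"
      unfolding S_def by (intro suminf_le order_trans[OF lipA] mult_left_mono hausdorff_mono) auto
    also have "\<dots> = ennreal (L powr s) * (\<Sum>i. emeasure (hausdorff_measure s) (Q n i))"
      using Q(3) by (simp add: emeasure_hausdorff_measure[OF s])
    also have "(\<Sum>i. emeasure (hausdorff_measure s) (Q n i)) = emeasure (hausdorff_measure s) (\<Union>i. Q n i)"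
      using Q by (intro suminf_emeasure) auto
    also have "\<dots> = hausdorff s (UNIV :: 'a set)"
      using Q(1) by (simp add: emeasure_hausdorff_measure[OF s])
    finally show ?thesis .
  qed
  have "(\<integral>\<^sup>+ z. liminf (\<lambda>n. N n z) \<partial>?H) \<le> liminf (\<lambda>n. \<integral>\<^sup>+ z. N n z \<partial>?H)"
    by (intro nn_integral_liminf N)
  also have "\<dots> \<le> limsup (\<lambda>n. \<integral>\<^sup>+ z. N n z \<partial>?H)"
    by (intro Liminf_le_Limsup) auto
  also have "\<dots> \<le> ennreal (L powr s) * hausdorff s (UNIV :: 'a set)"
    by (intro Limsup_bounded always_eventually allI intN)
  also have "\<dots> < \<infinity>" using fin by (simp add: ennreal_mult_less_top)
  finally have "AE z in ?H. liminf (\<lambda>n. N n z) \<noteq> \<infinity>"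
    by (intro nn_integral_noteq_infinite) auto
  moreover have meas: "{z. liminf (\<lambda>n. N n z) = \<infinity>} \<in> sets ?H"
  proof -
    have "{z \<in> space ?H. liminf (\<lambda>n. N n z) = \<infinity>} \<in> sets ?H" by measurable
    then show ?thesis by simp
  qed
  ultimately have "emeasure ?H {z. liminf (\<lambda>n. N n z) = \<infinity>} = 0"
    by (subst (asm) AE_iff_measurable[OF meas]) auto
  then have null: "hausdorff s {z. liminf (\<lambda>n. N n z) = \<infinity>} = 0"
    using meas emeasure_hausdorff_measure[OF s, of "{z. liminf (\<lambda>n. N n z) = \<infinity>}"] by simp
  have null': "hausdorff s (f ` (- ?K)) = 0" using lipA[of "- ?K"] K(3) by simp
  \<comment> \<open>A point of the intersection has an infinite fibre, since a finite one has a
    positive minimal separation. If the fibre lies in \<open>?K\<close>, the counts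
    \<open>N n z\<close> eventually exceed every bound.\<close>
  have "(\<Inter>n. close_fibre f (1 / real (Suc n))) \<subseteq> f ` (- ?K) \<union> {z. liminf (\<lambda>n. N n z) = \<infinity>}"
  proof (rule subsetI, rule ccontr)
    fix z assume zI: "z \<in> (\<Inter>n. close_fibre f (1 / real (Suc n)))"
      and nz: "z \<notin> f ` (- ?K) \<union> {z. liminf (\<lambda>n. N n z) = \<infinity>}"
    define G where "G = {x. f x = z}"
    have GK: "G \<subseteq> ?K" using nz by (auto simp: G_def)
    have "infinite G"
    proof
      assume "finite G"
      then obtain n where n: "\<And>x y. x \<in> G \<Longrightarrow> y \<in> G \<Longrightarrow> x \<noteq> y \<Longrightarrow> 1 / real (Suc n) < dist x y"
        by (rule finite_set_dist_lower_bound) blast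
      have "z \<in> close_fibre f (1 / real (Suc n))" using zI by blast
      then obtain x y where "x \<noteq> y" "dist x y \<le> 1 / real (Suc n)" "x \<in> G" "y \<in> G"
        by (auto simp: close_fibre_def G_def)
      then show False using n[of x y] by simp
    qed
    have "of_nat k \<le> liminf (\<lambda>n. N n z)" for k
    proof -
      obtain T where T: "finite T" "card T = k" "T \<subseteq> G"
        using infinite_arbitrarily_large[OF \<open>infinite G\<close>] by blast
      obtain m where m: "\<And>x y. x \<in> T \<Longrightarrow> y \<in> T \<Longrightarrow> x \<noteq> y \<Longrightarrow> 1 / real (Suc m) < dist x y"
        using finite_set_dist_lower_bound[OF T(1)] by blast
      \<comment> \<open>Once the mesh is below the separation of \<open>T\<close>, its
        \<open>k\<close> points lie in different pieces, each of which is counted.\<close>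
      have "of_nat k \<le> N n z" if "m \<le> n" for n
      proof -
        have "\<forall>x. \<exists>i. x \<in> Q n i" using Q(1)[of n] by blast
        from choice[OF this] obtain \<iota> where \<iota>: "\<And>x. x \<in> Q n (\<iota> x)" by blast
        have mn: "1 / real (Suc n) \<le> 1 / real (Suc m)" using that by (intro frac_le) auto
        have inj: "inj_on \<iota> T"
        proof (rule inj_onI, rule ccontr)
          fix x y assume xy: "x \<in> T" "y \<in> T" "\<iota> x = \<iota> y" "x \<noteq> y"
          have "dist x y \<le> 1 / real (Suc n)" using dQ[OF \<iota>[of x]] \<iota>[of y] xy(3) by simp
          then show False using m[OF xy(1,2,4)] mn by simp
        qed
        have "of_nat k = (\<Sum>i\<in>\<iota> ` T. 1 :: ennreal)" using T inj by (simp add: card_image)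
        also have "\<dots> = (\<Sum>i\<in>\<iota> ` T. indicator (S n i) z)"
        proof (intro sum.cong refl)
          fix i assume "i \<in> \<iota> ` T"
          then obtain x where x: "x \<in> T" "i = \<iota> x" by blast
          then have "x \<in> ?K \<inter> Q n i" "f x = z" using T(3) GK \<iota>[of x] by (auto simp: G_def)
          then have "z \<in> S n i" unfolding S_def by blast
          then show "1 = (indicator (S n i) z :: ennreal)" by simp
        qed
        also have "\<dots> \<le> N n z" unfolding N_def using T(1) by (intro sum_le_suminf) auto
        finally show ?thesis .
      qed
      then show ?thesis
        by (intro Liminf_bounded) (auto simp: eventually_sequentially)
    qed
    then have "\<not> liminf (\<lambda>n. N n z) < top" using ennreal_Ex_less_of_nat by (metis not_le)
    then show False using nz by (auto simp: top.not_eq_extremum)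
  qed
  then show ?thesis using hausdorff_null_Un[OF null' null] hausdorff_null_subset by blast
qed

text \<open>Up to a null set, the close fibre is exhausted by the closed sets \<open>C n\<close>,
  images of compact sets of pairs with equal values. Requiring the pairs to be at least
  \<open>1 / real (Suc n)\<close> apart turns \<open>x \<noteq> y\<close> into a closed
  condition.\<close>

lemma hausdorff_AE_zero_density_close_fibre:
  fixes f :: "'a::complete_space \<Rightarrow> 'b::metric_space"
  assumes s: "0 < s" and L: "0 < L" and lip: "L-lipschitz_on UNIV f"
    and fin: "hausdorff s (UNIV :: 'a set) < top"
  shows "hausdorff s {z. z \<notin> close_fibre f \<rho> \<and> \<not> zero_density s (close_fibre f \<rho>) z} = 0"
proof -
  obtain K :: "nat \<Rightarrow> 'a set" where K: "\<And>n. compact (K n)" "incseq K" "hausdorff s (- (\<Union>n. K n)) = 0"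
    using hausdorff_tight[OF less_imp_le[OF s] fin] by blast
  have cont: "continuous_on UNIV f" using lip by (rule lipschitz_on_continuous_on)
  have lipA: "hausdorff s (f ` A) \<le> ennreal (L powr s) * hausdorff s A" for A
    using s L lipschitz_on_subset[OF lip] by (intro hausdorff_lipschitz_image_le) auto
  define P where "P n = (K n \<times> K n) \<inter> {p. 1 / real (Suc n) \<le> dist (fst p) (snd p)}
    \<inter> {p. dist (fst p) (snd p) \<le> \<rho>} \<inter> {p. f (fst p) = f (snd p)}" for n
  define C where "C n = (\<lambda>p. f (fst p)) ` P n" for n
  have contf: "continuous_on A (\<lambda>p. f (fst p))" "continuous_on A (\<lambda>p. f (snd p))" for A :: "('a \<times> 'a) set"
    by (auto intro!: continuous_on_compose2[OF cont] continuous_intros)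
  have "compact (P n)" for n
    unfolding P_def
    by (intro compact_Int_closed compact_Times K(1) closed_Collect_le closed_Collect_eq continuous_intros contf)
  then have clC: "closed (C n)" for n
    unfolding C_def by (intro compact_imp_closed compact_continuous_image contf)
  have "P m \<subseteq> P n" if "m \<le> n" for m n
  proof -
    have "1 / real (Suc n) \<le> 1 / real (Suc m)" using that by (intro frac_le) auto
    moreover have "K m \<subseteq> K n" using K(2) that by (auto simp: incseq_def)
    ultimately show ?thesis unfolding P_def by (intro Int_mono Sigma_mono order_refl) auto
  qed
  then have incC: "incseq C" unfolding incseq_def C_def by (blast intro: image_mono)
  have CM: "C n \<subseteq> close_fibre f \<rho>" for n
  proof
    fix z assume "z \<in> C n"
    then obtain x y where xy: "(x, y) \<in> P n" "z = f x" by (auto simp: C_def)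
    moreover have "0 < 1 / real (Suc n)" by simp
    ultimately have "0 < dist x y" unfolding P_def by (auto simp del: zero_less_dist_iff intro: less_le_trans)
    then show "z \<in> close_fibre f \<rho>" using xy unfolding P_def close_fibre_def by auto
  qed
  have "close_fibre f \<rho> - (\<Union>n. C n) \<subseteq> f ` (- (\<Union>n. K n))"
  proof (rule subsetI, rule ccontr)
    fix z assume z: "z \<in> close_fibre f \<rho> - (\<Union>n. C n)" "z \<notin> f ` (- (\<Union>n. K n))"
    then obtain x y where xy: "x \<noteq> y" "dist x y \<le> \<rho>" "f x = z" "f y = z" by (auto simp: close_fibre_def)
    then have "x \<in> (\<Union>n. K n)" "y \<in> (\<Union>n. K n)" using z(2) by (metis ComplI image_eqI)+
    then obtain i j where ij: "x \<in> K i" "y \<in> K j" by blast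
    have "0 < dist x y" using xy(1) by simp
    then obtain k where k: "1 / real (Suc k) < dist x y" by (rule nat_approx_posE)
    define n where "n = max (max i j) k"
    have "K i \<subseteq> K n" "K j \<subseteq> K n" using K(2) by (auto simp: incseq_def n_def)
    moreover have "1 / real (Suc n) \<le> 1 / real (Suc k)" by (intro frac_le) (auto simp: n_def)
    ultimately have "(x, y) \<in> P n" using ij xy k unfolding P_def by auto
    then have "z \<in> C n" using xy(3) unfolding C_def by force
    then show False using z(1) by blast
  qed
  then have null: "hausdorff s (close_fibre f \<rho> - (\<Union>n. C n)) = 0"
    using lipA[of "- (\<Union>n. K n)"] K(3) by (auto intro: hausdorff_null_subset)
  have "close_fibre f \<rho> \<subseteq> range f" by (auto simp: close_fibre_def)
  then have "hausdorff s (close_fibre f \<rho>) \<le> ennreal (L powr s) * hausdorff s (UNIV :: 'a set)"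
    by (intro order_trans[OF hausdorff_mono lipA])
  also have "\<dots> < top" using fin by (simp add: ennreal_mult_less_top)
  finally show ?thesis by (intro hausdorff_AE_zero_density[OF s _ clC CM incC null])
qed

section \<open>Maps whose images fill balls\<close>

text \<open>The quantified form of being good: \<open>a\<close> bounds the share missed by the image
  and \<open>b\<close> the size of balls in the target, at all scales below \<open>R\<close>.
  Filling more than half will mean \<open>2 * a < b\<close>; powers of \<open>2\<close> are absorbed
  into both constants.\<close>

definition image_fills ::
    "real \<Rightarrow> ('a::metric_space \<Rightarrow> 'b::metric_space) \<Rightarrow> real \<Rightarrow> real \<Rightarrow> real \<Rightarrow> real \<Rightarrow> 'a \<Rightarrow> bool" where
  "image_fills s f l a b R x \<longleftrightarrow> (\<forall>r. 0 < r \<and> r < R \<longrightarrow>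
     hausdorff s (ball (f x) (l * r) - f ` ball x r) \<le> ennreal (a * (l * r) powr s) \<and>
     ennreal (b * r powr s) \<le> hausdorff s (ball (f x) r))"

lemma image_fillsD:
  assumes "image_fills s f l a b R x" "0 < r" "r < R"
  shows "hausdorff s (ball (f x) (l * r) - f ` ball x r) \<le> ennreal (a * (l * r) powr s)"
    "ennreal (b * r powr s) \<le> hausdorff s (ball (f x) r)"
  using assms unfolding image_fills_def by blast+

text \<open>\<open>W\<close> is replaced by a null G-delta set, so the complement \<open>A\<close>
  of its preimage is a countable union of closed sets. Were \<open>A\<close> of density zero at a
  good point over \<open>W\<close>, the image of a small ball would be null up to the small image of
  its part in \<open>A\<close>, too little to fill the target ball. Hence all such points are
  exceptional in the density theorem.\<close>

lemma hausdorff_null_preimage: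
  fixes f :: "'a::metric_space \<Rightarrow> 'b::metric_space"
  assumes s: "0 < s" and L: "0 < L" and lip: "L-lipschitz_on UNIV f"
    and fin: "hausdorff s (UNIV :: 'a set) < top" and W: "hausdorff s W = 0"
    and l: "0 < l" "l \<le> 1" and a: "0 \<le> a" "a < b" and R: "0 < R"
  shows "hausdorff s {x. image_fills s f l a b R x \<and> f x \<in> W} = 0"
proof -
  obtain U :: "nat \<Rightarrow> 'b set" where U: "\<And>n. open (U n)" "W \<subseteq> (\<Inter>n. U n)" "hausdorff s (\<Inter>n. U n) = 0"
    using hausdorff_null_G_delta_hull[OF s W] by blast
  have cont: "continuous_on UNIV f" using lip by (rule lipschitz_on_continuous_on)
  have lipA: "hausdorff s (f ` A) \<le> ennreal (L powr s) * hausdorff s A" for A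
    using s L lipschitz_on_subset[OF lip] by (intro hausdorff_lipschitz_image_le) auto
  define A where "A = - (f -` (\<Inter>n. U n))"
  define D where "D n = (\<Union>i\<le>n. f -` (- U i))" for n
  have clD: "closed (D n)" for n
    unfolding D_def using U(1) cont by (intro closed_UN ballI closed_vimage) auto
  have "f -` (- U n) \<subseteq> D n" for n unfolding D_def by auto
  then have "A \<subseteq> (\<Union>n. D n)" unfolding A_def by blast
  moreover have "(\<Union>n. D n) \<subseteq> A" unfolding D_def A_def by blast
  ultimately have UND: "(\<Union>n. D n) = A" by (rule antisym[rotated])
  have DA: "D n \<subseteq> A" for n using UND by blast
  have incD: "incseq D" unfolding incseq_def D_def by (intro allI impI UN_mono) auto
  have finA: "hausdorff s A < top" using hausdorff_mono[OF subset_UNIV, of s A] fin by (rule le_less_trans)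
  have null: "hausdorff s {x. x \<notin> A \<and> \<not> zero_density s A x} = 0"
    using UND by (intro hausdorff_AE_zero_density[OF s finA clD DA incD]) simp
  have "{x. image_fills s f l a b R x \<and> f x \<in> W} \<subseteq> {x. x \<notin> A \<and> \<not> zero_density s A x}"
  proof clarify
    fix x assume fill: "image_fills s f l a b R x" and x: "f x \<in> W"
    have "\<not> zero_density s A x"
    proof
      assume zd: "zero_density s A x"
      \<comment> \<open>Chosen so that \<open>L powr s * (t * r powr s)\<close> is half of the gap
        between \<open>b\<close> and \<open>a\<close> times \<open>(l * r) powr s\<close>.\<close>
      define t where "t = (b - a) * l powr s / (2 * L powr s)"
      have t: "0 < t" using a l L by (simp add: t_def)
      obtain R' where R': "0 < R'"
        "\<And>r. 0 < r \<Longrightarrow> r < R' \<Longrightarrow> hausdorff s (A \<inter> ball x r) \<le> ennreal (t * r powr s)"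
        by (rule zero_densityE[OF zd t]) (rule that, assumption+)
      define r where "r = min R R' / 2"
      have r: "0 < r" "r < R" "r < R'" using R R' by (auto simp: r_def)
      have "l * r \<le> r" using l r by (intro mult_left_le_one_le) auto
      from le_less_trans[OF this] have lr: "0 < l * r" "l * r < R" using l r by auto
      define w where "w = (l * r) powr s"
      have w: "0 < w" using l r by (simp add: w_def)
      have "hausdorff s (f ` ball x r) \<le> hausdorff s ((\<Inter>n. U n) \<union> f ` (A \<inter> ball x r))"
        by (rule hausdorff_mono) (auto simp: A_def)
      also have "\<dots> \<le> hausdorff s (\<Inter>n. U n) + hausdorff s (f ` (A \<inter> ball x r))" by (rule hausdorff_Un_le)
      also have "\<dots> = hausdorff s (f ` (A \<inter> ball x r))" using U(3) by simp
      also have "\<dots> \<le> ennreal (L powr s) * ennreal (t * r powr s)"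
        by (intro order_trans[OF lipA] mult_left_mono R' r) auto
      also have "\<dots> = ennreal ((b - a) / 2 * w)"
        using L l r a by (simp add: ennreal_mult'[symmetric] t_def w_def powr_mult)
      finally have 1: "hausdorff s (f ` ball x r) \<le> ennreal ((b - a) / 2 * w)" .
      have "ennreal (b * w) \<le> hausdorff s (ball (f x) (l * r))"
        unfolding w_def by (rule image_fillsD(2)[OF fill lr])
      also have "\<dots> \<le> hausdorff s ((ball (f x) (l * r) - f ` ball x r) \<union> f ` ball x r)"
        by (rule hausdorff_mono) auto
      also have "\<dots> \<le> hausdorff s (ball (f x) (l * r) - f ` ball x r) + hausdorff s (f ` ball x r)"
        by (rule hausdorff_Un_le)
      also have "\<dots> \<le> ennreal (a * w) + ennreal ((b - a) / 2 * w)"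
        unfolding w_def using image_fillsD(1)[OF fill r(1,2)] 1[unfolded w_def] by (rule add_mono)
      also have "\<dots> = ennreal (a * w + (b - a) / 2 * w)" using a w by (simp add: ennreal_plus)
      finally have "b * w \<le> a * w + (b - a) / 2 * w"
        using a w by (subst (asm) ennreal_le_iff) (auto intro!: add_nonneg_nonneg mult_nonneg_nonneg)
      then have "b * w \<le> (a + (b - a) / 2) * w" by (simp only: distrib_right)
      then have "b \<le> a + (b - a) / 2" using w by (rule mult_right_le_imp_le)
      then show False using a by (simp add: field_simps)
    qed
    moreover have "x \<notin> A" using x U(2) by (auto simp: A_def)
    ultimately show "x \<notin> A \<and> \<not> zero_density s A x" by blast
  qed
  then show ?thesis using null hausdorff_null_subset by blast
qed

text \<open>If the bound failed, a slightly smaller ball around \<open>f x\<close> would lie in both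
  target balls. It would be covered by the two missed parts and the close fibre, which together are
  too small.\<close>

lemma image_fills_lower_bound:
  fixes f :: "'a::metric_space \<Rightarrow> 'b::metric_space"
  assumes s: "0 < s" and l: "0 < l" "l \<le> 1" and a: "0 \<le> a" "2 * a < b" and R: "0 < R" and \<rho>: "0 < \<rho>"
    and fx: "image_fills s f l a b R x" and zd: "zero_density s (close_fibre f \<rho>) (f x)"
  obtains e where "0 < e"
    "\<And>y. image_fills s f l a b R y \<Longrightarrow> dist x y < e \<Longrightarrow> e * dist x y \<le> dist (f x) (f y)"
proof -
  \<comment> \<open>The strict inequality \<open>2 * a < b\<close> survives shrinking the radius by
    a factor \<open>1 - \<epsilon>\<close>.\<close>
  have "((\<lambda>\<epsilon>. b * (1 - \<epsilon>) powr s) \<longlongrightarrow> b * (1 - 0) powr s) (at_right 0)"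
    by (intro tendsto_intros) auto
  then have "\<forall>\<^sub>F \<epsilon> in at_right 0. 2 * a < b * (1 - \<epsilon>) powr s"
    using a by (intro order_tendstoD(1)) auto
  moreover have "\<forall>\<^sub>F \<epsilon> in at_right 0. 0 < \<epsilon> \<and> \<epsilon> < (1::real)"
    by (auto simp: eventually_at_right_field intro!: exI[of _ 1])
  ultimately have "\<forall>\<^sub>F \<epsilon> in at_right 0. 2 * a < b * (1 - \<epsilon>) powr s \<and> 0 < \<epsilon> \<and> \<epsilon> < 1"
    by eventually_elim simp
  then obtain \<epsilon> where \<epsilon>: "2 * a < b * (1 - \<epsilon>) powr s" "0 < \<epsilon>" "\<epsilon> < 1"
    using eventually_happens'[OF trivial_limit_at_right_real] by blast
  \<comment> \<open>Half of the remaining gap, so that \<open>2 * a + t\<close> still stays below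
    \<open>b * (1 - \<epsilon>) powr s\<close>.\<close>
  define t where "t = (b * (1 - \<epsilon>) powr s - 2 * a) / 2"
  have t: "0 < t" using \<epsilon> by (simp add: t_def)
  obtain R' where R': "0 < R'"
    "\<And>r. 0 < r \<Longrightarrow> r < R' \<Longrightarrow> hausdorff s (close_fibre f \<rho> \<inter> ball (f x) r) \<le> ennreal (t * r powr s)"
    by (rule zero_densityE[OF zd t]) (rule that, assumption+)
  \<comment> \<open>With \<open>r\<close> half of \<open>dist x y\<close>, the first two bounds put
    \<open>r\<close> below \<open>R\<close> and \<open>R'\<close>, the third gives
    \<open>4 * r \<le> \<rho>\<close>, and the last makes \<open>e * dist x y\<close> at most
    \<open>\<epsilon> * (l * r)\<close>.\<close>
  define e where "e = min (min (2 * R) (2 * R')) (min (\<rho> / 2) (\<epsilon> * l / 2))"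
  have e: "0 < e" "e \<le> 2 * R" "e \<le> 2 * R'" "e \<le> \<rho> / 2" "e \<le> \<epsilon> * l / 2"
    using R R' \<rho> \<epsilon> l by (auto simp: e_def)
  show ?thesis
  proof (rule that[OF e(1)], rule ccontr)
    fix y assume fy: "image_fills s f l a b R y" and xy: "dist x y < e"
      and neg: "\<not> e * dist x y \<le> dist (f x) (f y)"
    have "x \<noteq> y" using neg by auto
    define r where "r = dist x y / 2"
    have r: "0 < r" "r < R" "r < R'" "4 * r \<le> \<rho>" "dist x y = 2 * r"
      using \<open>x \<noteq> y\<close> xy e by (auto simp: r_def)
    have "l * r \<le> r" using l r by (intro mult_left_le_one_le) auto
    from le_less_trans[OF this] have lr: "0 < l * r" "l * r < R" "l * r < R'" using l r by auto
    have "e * dist x y \<le> \<epsilon> * l / 2 * (2 * r)" unfolding r(5) using e r by (intro mult_right_mono) auto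
    then have close: "dist (f x) (f y) < \<epsilon> * (l * r)" using neg by simp
    have "(1 - \<epsilon>) * (l * r) \<le> l * r" using \<epsilon> lr by (intro mult_left_le_one_le) auto
    from le_less_trans[OF this] have er: "0 < (1 - \<epsilon>) * (l * r)" "(1 - \<epsilon>) * (l * r) < R"
      using \<epsilon> lr by auto
    have "ball (f x) ((1 - \<epsilon>) * (l * r)) \<subseteq> (ball (f x) (l * r) - f ` ball x r) \<union>
        (ball (f y) (l * r) - f ` ball y r) \<union> (close_fibre f \<rho> \<inter> ball (f x) (l * r))"
    proof
      fix z assume z: "z \<in> ball (f x) ((1 - \<epsilon>) * (l * r))"
      then have dx: "dist (f x) z < (1 - \<epsilon>) * (l * r)" by simp
      have "(1 - \<epsilon>) * (l * r) = l * r - \<epsilon> * (l * r)" by (simp add: left_diff_distrib)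
      moreover have "0 < \<epsilon> * (l * r)" using \<epsilon> lr by simp
      ultimately have zx: "z \<in> ball (f x) (l * r)" and zy: "z \<in> ball (f y) (l * r)"
        using dx close dist_triangle[of "f y" z "f x"] by (auto simp: dist_commute)
      show "z \<in> (ball (f x) (l * r) - f ` ball x r) \<union>
        (ball (f y) (l * r) - f ` ball y r) \<union> (close_fibre f \<rho> \<inter> ball (f x) (l * r))"
      proof (cases "z \<in> f ` ball x r \<and> z \<in> f ` ball y r")
        case True
        then obtain u v where uv: "dist x u < r" "dist y v < r" "f u = z" "f v = z" by auto
        \<comment> \<open>The balls \<open>ball x r\<close> and \<open>ball y r\<close> are disjoint
          because their centres are \<open>2 * r\<close> apart; points of them are less than
          \<open>4 * r\<close> apart.\<close>
        then have "u \<noteq> v" using dist_triangle[of x y u] r(5) by (auto simp: dist_commute)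
        moreover have "dist u v \<le> \<rho>"
          using uv r(4,5) dist_triangle[of u v x] dist_triangle[of x v y] by (simp add: dist_commute)
        ultimately have "z \<in> close_fibre f \<rho>" using uv unfolding close_fibre_def by blast
        then show ?thesis using zx by blast
      qed (use zx zy in blast)
    qed
    then have "hausdorff s (ball (f x) ((1 - \<epsilon>) * (l * r))) \<le>
        hausdorff s (ball (f x) (l * r) - f ` ball x r) + hausdorff s (ball (f y) (l * r) - f ` ball y r)
        + hausdorff s (close_fibre f \<rho> \<inter> ball (f x) (l * r))"
      by (rule hausdorff_le_sum3)
    also have "\<dots> \<le> ennreal (a * (l * r) powr s) + ennreal (a * (l * r) powr s) + ennreal (t * (l * r) powr s)"
      by (intro add_mono image_fillsD(1)[OF fx] image_fillsD(1)[OF fy] R' r lr)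
    also have "\<dots> = ennreal ((2 * a + t) * (l * r) powr s)"
      using a t by (simp add: ennreal_plus[symmetric] algebra_simps del: ennreal_plus)
    finally have "ennreal (b * ((1 - \<epsilon>) * (l * r)) powr s) \<le> ennreal ((2 * a + t) * (l * r) powr s)"
      using image_fillsD(2)[OF fx er] by (rule order_trans[rotated])
    then have "b * ((1 - \<epsilon>) * (l * r)) powr s \<le> (2 * a + t) * (l * r) powr s"
      using a t by (subst (asm) ennreal_le_iff) auto
    then have "(b * (1 - \<epsilon>) powr s) * (l * r) powr s \<le> (2 * a + t) * (l * r) powr s"
      by (simp only: powr_mult mult.assoc)
    then have "b * (1 - \<epsilon>) powr s \<le> 2 * a + t"
      by (rule mult_right_le_imp_le) (use l r in simp)
    then show False using \<epsilon>(1) unfolding t_def by argo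
  qed
qed

text \<open>The strict inequality between the limits leaves room to make all constants rational, so
  that countably many parameter choices suffice.\<close>

lemma image_fills_rational_parameters:
  fixes f :: "'a::metric_space \<Rightarrow> 'b::metric_space"
  assumes s: "0 < s" and lam: "0 < lam" "lam \<le> 1"
    and lim: "Limsup (at_right 0)
           (\<lambda>r. hausdorff s (ball (f x) (lam * r) - f ` ball x r) / ennreal ((2 * lam * r) powr s))
         < (1/2) * lower_density s (UNIV :: 'b set) (f x)"
  obtains l a b R where "l \<in> \<rat>" "a \<in> \<rat>" "b \<in> \<rat>" "R \<in> \<rat>" "0 < l" "l \<le> 1" "0 \<le> a" "2 * a < b" "0 < R"
    "image_fills s f l a b R x"
proof -
  let ?T = "\<lambda>r. hausdorff s (ball (f x) (lam * r) - f ` ball x r) / ennreal ((2 * lam * r) powr s)"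
  let ?D = "\<lambda>r. hausdorff s (ball (f x) r \<inter> UNIV) / ennreal ((2 * r) powr s)"
  obtain c where c: "Limsup (at_right 0) ?T < c" "c < (1/2) * lower_density s (UNIV :: 'b set) (f x)"
    using dense[OF lim] by blast
  have "c < top" using c(2) by (rule less_le_trans) simp
  then obtain c0 where c0: "c = ennreal c0" "0 \<le> c0" by (cases c) auto
  have "2 * c < 2 * ((1/2) * lower_density s (UNIV :: 'b set) (f x))"
    using c(2) by (intro ennreal_mult_strict_left_mono) auto
  also have "\<dots> = lower_density s (UNIV :: 'b set) (f x)"
    by (simp add: mult.assoc[symmetric] ennreal_times_divide)
  finally obtain d where d: "2 * c < d" "d < lower_density s (UNIV :: 'b set) (f x)" using dense by blast
  have "d < top" using d(2) by (rule less_le_trans) simp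
  then obtain d0 where d0: "d = ennreal d0" "0 \<le> d0" by (cases d) auto
  have "ennreal (2 * c0) < ennreal d0" using d(1) c0 d0 by (simp add: ennreal_mult)
  then have cd: "2 * c0 < d0" using c0 by (simp add: ennreal_less_iff)
  have "\<forall>\<^sub>F r in at_right 0. ?T r < c" using c(1) by (rule Limsup_lessD)
  moreover have "\<forall>\<^sub>F r in at_right 0. d < ?D r" using d(2) unfolding lower_density_def by (rule less_LiminfD)
  ultimately have "\<forall>\<^sub>F r in at_right 0. ?T r < c \<and> d < ?D r" by eventually_elim simp
  then obtain R1 where R1: "0 < R1" "\<And>r. 0 < r \<Longrightarrow> r < R1 \<Longrightarrow> ?T r < c \<and> d < ?D r"
    unfolding eventually_at_right_field by blast
  \<comment> \<open>The densities are normalised by powers of \<open>2 * r\<close>; the factor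
    \<open>2 powr s\<close> moves into the constants.\<close>
  define a0 b0 where "a0 = c0 * 2 powr s" and "b0 = d0 * 2 powr s"
  have ab: "0 \<le> a0" "2 * a0 < b0" using c0 cd by (auto simp: a0_def b0_def)
  have T: "hausdorff s (ball (f x) (lam * r) - f ` ball x r) \<le> ennreal (a0 * (lam * r) powr s)"
    and D: "ennreal (b0 * r powr s) \<le> hausdorff s (ball (f x) r)" if r: "0 < r" "r < R1" for r
  proof -
    have "?T r \<le> c" "d \<le> ?D r" using R1(2)[OF r] by auto
    then have *: "?T r * ennreal ((2 * lam * r) powr s) \<le> c * ennreal ((2 * lam * r) powr s)"
      "d * ennreal ((2 * r) powr s) \<le> ?D r * ennreal ((2 * r) powr s)"
      by (intro mult_right_mono; simp)+
    have cancel: "h / ennreal u * ennreal u = h" if "0 < u" for h u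
      using that by (simp add: ennreal_divide_times mult_divide_eq_ennreal)
    have p: "0 < (2 * lam * r) powr s" "0 < (2 * r) powr s" using r lam by auto
    show "hausdorff s (ball (f x) (lam * r) - f ` ball x r) \<le> ennreal (a0 * (lam * r) powr s)"
      using *(1) c0 unfolding cancel[OF p(1)]
      by (simp add: a0_def ennreal_mult'[symmetric] powr_mult mult.assoc)
    show "ennreal (b0 * r powr s) \<le> hausdorff s (ball (f x) r)"
      using *(2) d0 unfolding cancel[OF p(2)]
      by (simp add: b0_def ennreal_mult'[symmetric] powr_mult mult.assoc)
  qed
  obtain b where b: "b \<in> \<rat>" "2 * a0 < b" "b < b0" using Rats_dense_in_real[OF ab(2)] by blast
  have "a0 < b / 2" using b by simp
  then obtain a where a: "a \<in> \<rat>" "a0 < a" "a < b / 2" using Rats_dense_in_real by blast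
  \<comment> \<open>Passing from \<open>lam\<close> to a smaller rational \<open>l\<close> shrinks
    the missed part but also the allowed bound; the slack \<open>a0 < a\<close> compensates for this
    when \<open>l\<close> is close to \<open>lam\<close>.\<close>
  have "((\<lambda>l. a * l powr s) \<longlongrightarrow> a * lam powr s) (at_left lam)"
    using lam by (intro tendsto_intros) auto
  moreover have "a0 * lam powr s < a * lam powr s" using a lam by simp
  ultimately have "\<forall>\<^sub>F l in at_left lam. a0 * lam powr s < a * l powr s" by (rule order_tendstoD(1))
  then obtain l0 where l0: "l0 < lam" "\<And>l. l0 < l \<Longrightarrow> l < lam \<Longrightarrow> a0 * lam powr s < a * l powr s"
    unfolding eventually_at_left_field by blast
  have "max 0 l0 < lam" using l0(1) lam by simp
  then obtain l where l: "l \<in> \<rat>" "max 0 l0 < l" "l < lam" using Rats_dense_in_real by blast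
  obtain R where R: "R \<in> \<rat>" "0 < R" "R < R1" using Rats_dense_in_real[OF R1(1)] by blast
  have "image_fills s f l a b R x"
    unfolding image_fills_def
  proof (intro allI impI conjI)
    fix r assume r: "0 < r \<and> r < R"
    have "ball (f x) (l * r) \<subseteq> ball (f x) (lam * r)" using l r by (intro subset_ball mult_right_mono) auto
    then have "hausdorff s (ball (f x) (l * r) - f ` ball x r) \<le> hausdorff s (ball (f x) (lam * r) - f ` ball x r)"
      by (intro hausdorff_mono) blast
    also have "\<dots> \<le> ennreal (a0 * (lam * r) powr s)" using r R by (intro T) auto
    also have "\<dots> = ennreal ((a0 * lam powr s) * r powr s)" by (simp add: powr_mult mult.assoc)
    also have "\<dots> \<le> ennreal ((a * l powr s) * r powr s)"
      using l0(2)[of l] l by (intro ennreal_leI mult_right_mono) auto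
    also have "\<dots> = ennreal (a * (l * r) powr s)" by (simp add: powr_mult mult.assoc)
    finally show "hausdorff s (ball (f x) (l * r) - f ` ball x r) \<le> ennreal (a * (l * r) powr s)" .
    have "ennreal (b * r powr s) \<le> ennreal (b0 * r powr s)" using b by (intro ennreal_leI mult_right_mono) auto
    also have "\<dots> \<le> hausdorff s (ball (f x) r)" using r R by (intro D) auto
    finally show "ennreal (b * r powr s) \<le> hausdorff s (ball (f x) r)" .
  qed
  then show ?thesis using l a b R lam ab by (intro that[of l a b R]) auto
qed

section \<open>The decomposition\<close>

text \<open>The inequality defines a closed set of pairs. This allows sets not known to be Borel to
  be replaced by their closures.\<close>

lemma closure_lower_lipschitz:
  fixes f :: "'a::metric_space \<Rightarrow> 'b::metric_space"
  assumes "continuous_on UNIV f" and E: "\<And>x y. x \<in> E \<Longrightarrow> y \<in> E \<Longrightarrow> dist x y \<le> c * dist (f x) (f y)"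
    and "x \<in> closure E" "y \<in> closure E"
  shows "dist x y \<le> c * dist (f x) (f y)"
proof -
  let ?S = "{p. dist (fst p) (snd p) \<le> c * dist (f (fst p)) (f (snd p))}"
  have "continuous_on UNIV (\<lambda>p. f (fst p))" "continuous_on UNIV (\<lambda>p. f (snd p))"
    by (auto intro!: continuous_on_compose2[OF assms(1)] continuous_intros)
  then have "closed ?S" by (intro closed_Collect_le continuous_intros)
  moreover have "E \<times> E \<subseteq> ?S" using E by auto
  ultimately have "closure (E \<times> E) \<subseteq> ?S" by (rule closure_minimal[rotated])
  then show ?thesis using assms(3,4) by (auto simp: closure_Times)
qed

text \<open>The lower bound gives injectivity and a Lipschitz inverse, and passes to subsets, so the
  cover may be made disjoint.\<close>

lemma bilipschitz_decomposition_of_closed_cover: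
  fixes f :: "'a::metric_space \<Rightarrow> 'b::metric_space" and F :: "nat \<Rightarrow> 'a set"
  assumes lip: "L-lipschitz_on UNIV f" and F: "\<And>n. closed (F n)" "hausdorff s (- (\<Union>n. F n)) = 0"
    and c: "\<And>n. 0 \<le> c n" "\<And>n x y. x \<in> F n \<Longrightarrow> y \<in> F n \<Longrightarrow> dist x y \<le> c n * dist (f x) (f y)"
  shows "\<exists>N (X :: nat \<Rightarrow> 'a set).
           N \<in> sets borel \<and> (\<forall>i. X i \<in> sets borel) \<and>
           UNIV = N \<union> (\<Union>i. X i) \<and>
           disjoint_family X \<and> (\<forall>i. N \<inter> X i = {}) \<and>
           hausdorff s N = 0 \<and>
           (\<forall>i. inj_on f (X i) \<and> (\<exists>L. L-lipschitz_on (X i) f) \<and>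
                (\<exists>L. L-lipschitz_on (f ` X i) (inv_into (X i) f)))"
proof (intro exI[of _ "- (\<Union>n. F n)"] exI[of _ "disjointed F"] conjI allI)
  have UN: "(\<Union>i. disjointed F i) = (\<Union>n. F n)" by (rule UN_disjointed_eq)
  have borel: "F n \<in> sets borel" for n using F(1) by (rule borel_closed)
  then have "(\<Union>n. F n) \<in> sets borel" by (intro sets.countable_UN) auto
  then show "- (\<Union>n. F n) \<in> sets borel" using borel_comp by blast
  show "disjointed F i \<in> sets borel" for i
    unfolding disjointed_def using borel by (intro sets.Diff sets.finite_UN) auto
  show "UNIV = - (\<Union>n. F n) \<union> (\<Union>i. disjointed F i)" unfolding UN by (rule Compl_partition2[symmetric])
  show "disjoint_family (disjointed F)" by (rule disjoint_family_disjointed)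
  show "- (\<Union>n. F n) \<inter> disjointed F i = {}" for i using disjointed_subset[of F i] by blast
  show "hausdorff s (- (\<Union>n. F n)) = 0" by (rule F(2))
  fix i
  have d: "dist x y \<le> c i * dist (f x) (f y)" if "x \<in> disjointed F i" "y \<in> disjointed F i" for x y
    using that disjointed_subset[of F i] by (intro c(2)) auto
  show inj: "inj_on f (disjointed F i)"
  proof (rule inj_onI)
    fix x y assume "x \<in> disjointed F i" "y \<in> disjointed F i" "f x = f y"
    then show "x = y" using d[of x y] by simp
  qed
  show "\<exists>L. L-lipschitz_on (disjointed F i) f" using lipschitz_on_subset[OF lip subset_UNIV] by blast
  have "(c i)-lipschitz_on (f ` disjointed F i) (inv_into (disjointed F i) f)"
    using c(1) inj d by (intro lipschitz_onI) auto
  then show "\<exists>L. L-lipschitz_on (f ` disjointed F i) (inv_into (disjointed F i) f)" by blast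
qed

lemma hausdorff_AE_image_fills_lower_bound:
  fixes f :: "'a::complete_space \<Rightarrow> 'b::metric_space"
  assumes s: "0 < s" and L: "0 < L" and lip: "L-lipschitz_on UNIV f"
    and fin: "hausdorff s (UNIV :: 'a set) < top"
    and l: "0 < l" "l \<le> 1" and a: "0 \<le> a" "2 * a < b" and R: "0 < R"
  shows "hausdorff s {x. image_fills s f l a b R x \<and> \<not> (\<exists>e>0. \<forall>y. image_fills s f l a b R y \<longrightarrow>
    dist x y < e \<longrightarrow> e * dist x y \<le> dist (f x) (f y))} = 0" (is "hausdorff s ?B = 0")
proof -
  let ?M = "\<lambda>n. close_fibre f (1 / real (Suc n))"
  \<comment> \<open>The values to be avoided: those with distinct preimages arbitrarily close
    together, and those outside some close fibre that fails to have density zero there.\<close>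
  define W where "W = (\<Inter>n. ?M n) \<union> (\<Union>n. {z. z \<notin> ?M n \<and> \<not> zero_density s (?M n) z})"
  have "hausdorff s W = 0"
    unfolding W_def
    by (intro hausdorff_null_Un hausdorff_Inter_close_fibre[OF less_imp_le[OF s] L lip fin] hausdorff_null_UN
        hausdorff_AE_zero_density_close_fibre[OF s L lip fin]) auto
  then have "hausdorff s {x. image_fills s f l a b R x \<and> f x \<in> W} = 0"
    using a by (intro hausdorff_null_preimage[OF s L lip fin _ l _ _ R]) auto
  moreover have "?B \<subseteq> {x. image_fills s f l a b R x \<and> f x \<in> W}"
  proof (rule subsetI, rule ccontr)
    fix x assume xB: "x \<in> ?B" and "x \<notin> {x. image_fills s f l a b R x \<and> f x \<in> W}"
    then have fill: "image_fills s f l a b R x" and xW: "f x \<notin> W" by auto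
    from xW obtain n where n: "f x \<notin> ?M n" by (auto simp: W_def)
    with xW have "zero_density s (?M n) (f x)" unfolding W_def by blast
    then obtain e where "0 < e"
      "\<And>y. image_fills s f l a b R y \<Longrightarrow> dist x y < e \<Longrightarrow> e * dist x y \<le> dist (f x) (f y)"
      by (rule image_fills_lower_bound[OF s l a R _ fill, rotated]) (rule that, assumption+, simp)
    then show False using xB by blast
  qed
  ultimately show ?thesis by (rule hausdorff_null_subset)
qed

theorem mainTheorem1:
  fixes f :: "'a::complete_space \<Rightarrow> 'b::complete_space" and s :: real
  assumes s_pos: "s > 0"
    and lip: "\<exists>L. L-lipschitz_on UNIV f"
    and fin: "hausdorff s (UNIV :: 'a set) < \<infinity>"
    and ae: "\<exists>Z. hausdorff s Z = 0 \<and>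
      (\<forall>x. x \<notin> Z \<longrightarrow> (\<exists>lam. 0 < lam \<and> lam \<le> 1 \<and>
         Limsup (at_right 0)
           (\<lambda>r. hausdorff s (ball (f x) (lam * r) - f ` ball x r) / ennreal ((2 * lam * r) powr s))
         < (1/2) * lower_density s (UNIV :: 'b set) (f x)))"
  shows "\<exists>N (X :: nat \<Rightarrow> 'a set).
           N \<in> sets borel \<and> (\<forall>i. X i \<in> sets borel) \<and>
           UNIV = N \<union> (\<Union>i. X i) \<and>
           disjoint_family X \<and> (\<forall>i. N \<inter> X i = {}) \<and>
           hausdorff s N = 0 \<and>
           (\<forall>i. inj_on f (X i) \<and> (\<exists>L. L-lipschitz_on (X i) f) \<and>
                (\<exists>L. L-lipschitz_on (f ` X i) (inv_into (X i) f)))"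
proof -
  obtain L0 where "L0-lipschitz_on UNIV f" using lip by blast
  \<comment> \<open>The maximum with \<open>1\<close> makes the Lipschitz constant positive.\<close>
  then have lipL: "(max L0 1)-lipschitz_on UNIV f" by (rule lipschitz_on_le) simp
  have L: "0 < max L0 1" by simp
  have cont: "continuous_on UNIV f" using lipL by (rule lipschitz_on_continuous_on)
  have fin': "hausdorff s (UNIV :: 'a set) < top" using fin by simp
  obtain Z where Z: "hausdorff s Z = 0" "\<And>x. x \<notin> Z \<Longrightarrow> \<exists>lam. 0 < lam \<and> lam \<le> 1 \<and>
         Limsup (at_right 0)
           (\<lambda>r. hausdorff s (ball (f x) (lam * r) - f ` ball x r) / ennreal ((2 * lam * r) powr s))
         < (1/2) * lower_density s (UNIV :: 'b set) (f x)"
    using ae by blast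
  obtain Q :: "'a set" where Q: "countable Q" "\<And>x e. 0 < e \<Longrightarrow> \<exists>q\<in>Q. dist q x < e"
    using hausdorff_finite_separable[OF fin'] by blast
  define P :: "(real \<times> real \<times> real \<times> real) set" where
    "P = {(l, a, b, R). l \<in> \<rat> \<and> a \<in> \<rat> \<and> b \<in> \<rat> \<and> R \<in> \<rat> \<and>
      0 < l \<and> l \<le> 1 \<and> 0 \<le> a \<and> 2 * a < b \<and> 0 < R}"
  define G where "G = (\<lambda>(l, a, b, R). {x. image_fills s f l a b R x})"
  have "P \<subseteq> \<rat> \<times> \<rat> \<times> \<rat> \<times> \<rat>" by (auto simp: P_def)
  then have cP: "countable P"
    by (rule countable_subset) (intro countable_SIGMA countable_rat)
  define B where "B p = {x \<in> G p. \<not> (\<exists>e>0. \<forall>y\<in>G p. dist x y < e \<longrightarrow> e * dist x y \<le> dist (f x) (f y))}" for p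
  have nullB: "hausdorff s (B p) = 0" if p: "p \<in> P" for p
  proof -
    obtain l a b R where p_eq: "p = (l, a, b, R)" by (cases p)
    then have "0 < l" "l \<le> 1" "0 \<le> a" "2 * a < b" "0 < R" using p by (auto simp: P_def)
    from hausdorff_AE_image_fills_lower_bound[OF s_pos L lipL fin' this]
    show ?thesis by (simp add: B_def G_def p_eq Ball_def)
  qed
  have cover: "x \<in> Z \<or> (\<exists>p\<in>P. x \<in> G p)" for x
  proof (cases "x \<in> Z")
    case False
    from Z(2)[OF this] obtain lam where lam: "0 < lam" "lam \<le> 1" "Limsup (at_right 0)
           (\<lambda>r. hausdorff s (ball (f x) (lam * r) - f ` ball x r) / ennreal ((2 * lam * r) powr s))
         < (1/2) * lower_density s (UNIV :: 'b set) (f x)"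
      by blast
    from image_fills_rational_parameters[OF s_pos lam] obtain l a b R
      where "l \<in> \<rat>" "a \<in> \<rat>" "b \<in> \<rat>" "R \<in> \<rat>" "0 < l" "l \<le> 1" "0 \<le> a" "2 * a < b" "0 < R"
        "image_fills s f l a b R x" .
    then show ?thesis by (intro disjI2 bexI[of _ "(l, a, b, R)"]) (auto simp: P_def G_def)
  qed simp
  \<comment> \<open>One index \<open>j\<close> makes both the radius of validity and the constant of
    the lower bound uniform.\<close>
  define E where "E p j = {x \<in> G p. \<forall>y\<in>G p. dist x y < 1 / real (Suc j) \<longrightarrow>
    dist x y \<le> real (Suc j) * dist (f x) (f y)}" for p j
  \<comment> \<open>Two points of a ball of this radius are less than
    \<open>1 / real (Suc j)\<close> apart, so the local bound defining \<open>E p j\<close> applies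
    to them.\<close>
  define piece where "piece = (\<lambda>(p, j, q). closure (E p j \<inter> ball q (1 / (2 * real (Suc j)))))"
  define J where "J = P \<times> (UNIV :: nat set) \<times> Q"
  have cJ: "countable J" unfolding J_def using cP Q(1) by (intro countable_SIGMA) auto
  \<comment> \<open>\<open>from_nat_into\<close> enumerates exactly \<open>J\<close> only if
    \<open>J\<close> is nonempty.\<close>
  have "(1, 0, 1, 1) \<in> P" by (simp add: P_def)
  moreover have "Q \<noteq> {}" using Q(2)[of 1] by auto
  ultimately have neJ: "J \<noteq> {}" unfolding J_def by blast
  have low: "dist x y \<le> real (Suc j) * dist (f x) (f y)"
    if "x \<in> piece (p, j, q)" "y \<in> piece (p, j, q)" for p j q x y
  proof (rule closure_lower_lipschitz[OF cont])
    show "x \<in> closure (E p j \<inter> ball q (1 / (2 * real (Suc j))))"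
      "y \<in> closure (E p j \<inter> ball q (1 / (2 * real (Suc j))))" using that by (auto simp: piece_def)
    fix u v assume u: "u \<in> E p j \<inter> ball q (1 / (2 * real (Suc j)))"
      and v: "v \<in> E p j \<inter> ball q (1 / (2 * real (Suc j)))"
    have "dist u v < 1 / (2 * real (Suc j)) + 1 / (2 * real (Suc j))"
      using u v dist_triangle[of u v q] by (auto simp: dist_commute)
    then have "dist u v < 1 / real (Suc j)" by (simp add: field_simps)
    then show "dist u v \<le> real (Suc j) * dist (f u) (f v)" using u v by (auto simp: E_def)
  qed
  have "- (\<Union>i\<in>J. piece i) \<subseteq> Z \<union> (\<Union>p\<in>P. B p)"
  proof (rule subsetI, rule ccontr)
    fix x assume x: "x \<in> - (\<Union>i\<in>J. piece i)" "x \<notin> Z \<union> (\<Union>p\<in>P. B p)"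
    then obtain p where p: "p \<in> P" "x \<in> G p" using cover[of x] by blast
    then have "x \<notin> B p" using x(2) by blast
    then obtain e where e: "e > 0" "\<And>y. y \<in> G p \<Longrightarrow> dist x y < e \<Longrightarrow> e * dist x y \<le> dist (f x) (f y)"
      using p(2) unfolding B_def by blast
    obtain j where j: "1 / real (Suc j) < e" using e(1) by (rule nat_approx_posE)
    have "x \<in> E p j"
      unfolding E_def
    proof (intro CollectI conjI ballI impI p(2))
      fix y assume y: "y \<in> G p" "dist x y < 1 / real (Suc j)"
      have "1 / real (Suc j) * dist x y \<le> e * dist x y" using j by (intro mult_right_mono) auto
      also have "\<dots> \<le> dist (f x) (f y)" using y j by (intro e(2)) auto
      finally show "dist x y \<le> real (Suc j) * dist (f x) (f y)" by (simp add: field_simps)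
    qed
    moreover have "0 < 1 / (2 * real (Suc j))" by simp
    from Q(2)[OF this] obtain q where q: "q \<in> Q" "dist q x < 1 / (2 * real (Suc j))" by blast
    ultimately have "x \<in> piece (p, j, q)" unfolding piece_def using closure_subset by fastforce
    moreover have "(p, j, q) \<in> J" using p(1) q(1) by (simp add: J_def)
    ultimately show False using x(1) by blast
  qed
  moreover have "hausdorff s (Z \<union> (\<Union>p\<in>P. B p)) = 0"
    by (intro hausdorff_null_Un Z(1) hausdorff_null_UN cP nullB)
  ultimately have null: "hausdorff s (- (\<Union>i\<in>J. piece i)) = 0" by (metis hausdorff_null_subset)
  define F where "F n = piece (from_nat_into J n)" for n
  define c where "c n = real (Suc (fst (snd (from_nat_into J n))))" for n
  show ?thesis
  proof (rule bilipschitz_decomposition_of_closed_cover[OF lipL])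
    show "closed (F n)" for n by (simp add: F_def piece_def split: prod.split)
    have "(\<Union>n. F n) = (\<Union>i\<in>range (from_nat_into J). piece i)" unfolding F_def by blast
    then show "hausdorff s (- (\<Union>n. F n)) = 0" using null range_from_nat_into[OF neJ cJ] by simp
    show "0 \<le> c n" for n by (simp add: c_def)
    fix n x y assume "x \<in> F n" "y \<in> F n"
    then show "dist x y \<le> c n * dist (f x) (f y)"
      unfolding F_def c_def by (cases "from_nat_into J n") (auto simp only: fst_conv snd_conv intro: low)
  qed
qed

end
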